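(* There are constants $\epsilon_0>0$ and $C>0$ such that the following holds for all $\epsilon\in[0,\epsilon_0]$, all $\nu\in(0,1]$, all $k\in\mathbb{Z}$ with $|k|\ge1$ and $\nu k^2\ge1$, and all $\lambda\in\mathbb{R}$. Let $\varphi$ be a solution on $I=(-1,1)$ of $$-\nu(\partial_y^2-k^2)^2\varphi+ik(y-\lambda)(\partial_y^2-k^2)\varphi-\epsilon\nu^{1/3}|k|^{2/3}(\partial_y^2-k^2)\varphi=F,\qquad \varphi(\pm1)=0,\ \varphi'(\pm1)=0,$$ and set $w=(\partial_y^2-k^2)\varphi$, $u=(-\partial_y\varphi,ik\varphi)$. (i) If $F\in L^2(I)$, then $$\nu^{5/12}|k|^{5/6}\|w\|_{L^2}\le\nu k^2\|w\|_{L^2}\le C\|F\|_{L^2}.$$ (ii) If $F\in H^{-1}(I)$, then $$(\nu k^2)^{1/2}\|u\|_{L^2}\le C\,\nu k^2\|u\|_{L^2}\le C^2\|F\|_{H^{-1}},\qquad \nu^{3/4}|k|^{1/2}\|w\|_{L^2}\le C\,\nu|k|\,\|w\|_{L^2}\le C^2\|F\|_{H^{-1}}.$$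
   Context: All norms are over $I=(-1,1)$; functions are complex-valued; $H^{-1}(I)$ is the dual of $H_0^1(I)$ (with the $H^1$ norm). *)

theory Defs
  imports "HOL-Analysis.Analysis"
begin

section \<open>Sobolev spaces on the interval \<open>(-1,1)\<close>\<close>

text \<open>
  Elements of function spaces are represented by functions on the whole real line; only their
  values almost everywhere on the interval matter.
\<close>

abbreviation I :: "real set" where
  "I \<equiv> {-1<..<1}"

definition L2 :: "(real \<Rightarrow> complex) set" where
  "L2 = {f. f \<in> borel_measurable (lebesgue_on I) \<and>
            integrable (lebesgue_on I) (\<lambda>y. (cmod (f y))\<^sup>2)}"

definition L2_norm :: "(real \<Rightarrow> complex) \<Rightarrow> real" where
  "L2_norm f = sqrt (\<integral>y. (cmod (f y))\<^sup>2 \<partial>lebesgue_on I)"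

abbreviation D :: "(real \<Rightarrow> complex) \<Rightarrow> real \<Rightarrow> complex" where
  "D f \<equiv> \<lambda>y. vector_derivative f (at y)"

definition test_functions :: "(real \<Rightarrow> complex) set" where
  "test_functions = {\<psi>. (\<forall>n y. (D ^^ n) \<psi> differentiable (at y)) \<and>
                        (\<exists>K. compact K \<and> K \<subseteq> I \<and> (\<forall>y. y \<notin> K \<longrightarrow> \<psi> y = 0))}"

text \<open>
  A distribution on the interval is represented by its action on test functions. The pairing of
  a function with a test function is bilinear (no complex conjugation).
\<close>

type_synonym distr = "(real \<Rightarrow> complex) \<Rightarrow> complex"

definition distr_of :: "(real \<Rightarrow> complex) \<Rightarrow> distr" where
  "distr_of f \<psi> = (\<integral>y. f y * \<psi> y \<partial>lebesgue_on I)"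

definition distr_deriv :: "distr \<Rightarrow> distr" where
  "distr_deriv T \<psi> = - T (D \<psi>)"

definition distr_mult :: "(real \<Rightarrow> complex) \<Rightarrow> distr \<Rightarrow> distr" where
  "distr_mult a T \<psi> = T (\<lambda>y. a y * \<psi> y)"

definition has_weak_deriv :: "(real \<Rightarrow> complex) \<Rightarrow> (real \<Rightarrow> complex) \<Rightarrow> bool" where
  "has_weak_deriv f g \<longleftrightarrow>
     f \<in> L2 \<and> g \<in> L2 \<and> (\<forall>\<psi>\<in>test_functions. distr_deriv (distr_of f) \<psi> = distr_of g \<psi>)"

text \<open>The weak derivative is determined up to a null set; \<open>weak_deriv\<close> picks a representative.\<close>

definition weak_deriv :: "(real \<Rightarrow> complex) \<Rightarrow> real \<Rightarrow> complex" where
  "weak_deriv f = (SOME g. has_weak_deriv f g)"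

definition H1 :: "(real \<Rightarrow> complex) set" where
  "H1 = {f. \<exists>g. has_weak_deriv f g}"

definition H2 :: "(real \<Rightarrow> complex) set" where
  "H2 = {f \<in> H1. weak_deriv f \<in> H1}"

definition H1_norm :: "(real \<Rightarrow> complex) \<Rightarrow> real" where
  "H1_norm f = sqrt ((L2_norm f)\<^sup>2 + (L2_norm (weak_deriv f))\<^sup>2)"

definition H10 :: "(real \<Rightarrow> complex) set" where
  "H10 = {f \<in> H1. \<exists>\<psi>. (\<forall>n. \<psi> n \<in> test_functions) \<and>
                      (\<lambda>n. H1_norm (\<lambda>y. f y - \<psi> n y)) \<longlonglongrightarrow> 0}"

text \<open>
  Bounded linear functionals on \<open>H10\<close>. Boundedness forces such a functional to take the same
  value on functions that agree almost everywhere; its values outside \<open>H10\<close> are irrelevant.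
\<close>

definition Hminus1 :: "distr set" where
  "Hminus1 = {F. (\<forall>f\<in>H10. \<forall>g\<in>H10. F (\<lambda>y. f y + g y) = F f + F g) \<and>
                 (\<forall>c. \<forall>f\<in>H10. F (\<lambda>y. c * f y) = c * F f) \<and>
                 (\<exists>M. \<forall>f\<in>H10. cmod (F f) \<le> M * H1_norm f)}"

definition Hminus1_norm :: "distr \<Rightarrow> real" where
  "Hminus1_norm F = (SUP f\<in>{f \<in> H10. H1_norm f \<le> 1}. cmod (F f))"

text \<open>The value of an \<open>H1\<close> function at an endpoint is that of its continuous representative.\<close>

definition has_boundary_value :: "(real \<Rightarrow> complex) \<Rightarrow> real \<Rightarrow> complex \<Rightarrow> bool" where
  "has_boundary_value f b c \<longleftrightarrow>
     (\<exists>g. continuous_on {-1..1} g \<and> (AE y in lebesgue_on I. g y = f y) \<and> g b = c)"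


section \<open>The clamped Orr--Sommerfeld type problem\<close>

definition distr_helmholtz :: "int \<Rightarrow> distr \<Rightarrow> distr" where
  "distr_helmholtz k T \<psi> = distr_deriv (distr_deriv T) \<psi> - of_int (k\<^sup>2) * T \<psi>"

definition OS_operator :: "real \<Rightarrow> real \<Rightarrow> int \<Rightarrow> real \<Rightarrow> distr \<Rightarrow> distr" where
  "OS_operator \<epsilon> \<nu> k lam T \<psi> =
     - of_real \<nu> * distr_helmholtz k (distr_helmholtz k T) \<psi>
     + \<i> * of_int k * distr_mult (\<lambda>y. of_real (y - lam)) (distr_helmholtz k T) \<psi>
     - of_real (\<epsilon> * \<nu> powr (1/3) * \<bar>real_of_int k\<bar> powr (2/3)) * distr_helmholtz k T \<psi>"

text \<open>
  The equation is understood in the sense of distributions. This includes every more regular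
  solution concept, such as \<open>\<phi> \<in> H\<^sup>4\<close> with the equation holding almost everywhere.
\<close>

definition OS_solution ::
  "real \<Rightarrow> real \<Rightarrow> int \<Rightarrow> real \<Rightarrow> distr \<Rightarrow> (real \<Rightarrow> complex) \<Rightarrow> bool" where
  "OS_solution \<epsilon> \<nu> k lam F \<phi> \<longleftrightarrow>
     \<phi> \<in> H2 \<and>
     (\<forall>\<psi>\<in>test_functions. OS_operator \<epsilon> \<nu> k lam (distr_of \<phi>) \<psi> = F \<psi>) \<and>
     has_boundary_value \<phi> (-1) 0 \<and> has_boundary_value \<phi> 1 0 \<and>
     has_boundary_value (weak_deriv \<phi>) (-1) 0 \<and> has_boundary_value (weak_deriv \<phi>) 1 0"

definition vorticity :: "int \<Rightarrow> (real \<Rightarrow> complex) \<Rightarrow> real \<Rightarrow> complex" where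
  "vorticity k \<phi> = (\<lambda>y. weak_deriv (weak_deriv \<phi>) y - of_int (k\<^sup>2) * \<phi> y)"

definition velocity :: "int \<Rightarrow> (real \<Rightarrow> complex) \<Rightarrow> real \<Rightarrow> complex \<times> complex" where
  "velocity k \<phi> = (\<lambda>y. (- weak_deriv \<phi> y, \<i> * of_int k * \<phi> y))"

definition L2_norm_vec :: "(real \<Rightarrow> complex \<times> complex) \<Rightarrow> real" where
  "L2_norm_vec u = sqrt (\<integral>y. (norm (u y))\<^sup>2 \<partial>lebesgue_on I)"

end

theory Submission
  imports Defs
begin

text \<open>
  The argument is a plain energy estimate. Pairing the equation with the conjugate of \<open>\<phi>\<close> and taking
  real parts gives \<open>\<nu> \<parallel>w\<parallel>\<^sup>2 \<le> \<bar>\<langle>F, \<phi>\<rangle>\<bar> + \<bar>k\<bar> \<parallel>\<phi>'\<parallel> \<parallel>\<phi>\<parallel> + \<delta> \<parallel>u\<parallel>\<^sup>2\<close> with \<open>\<delta> = \<epsilon> (\<nu> k\<^sup>2) powr (1/3)\<close>; only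
  the commutator of the shear with the derivative survives in the middle term, which is at most
  \<open>\<parallel>u\<parallel>\<^sup>2 / 2\<close>. Since \<open>k\<^sup>2 \<parallel>u\<parallel>\<^sup>2 \<le> \<parallel>w\<parallel>\<^sup>2\<close> and \<open>\<nu> k\<^sup>2 \<ge> 1\<close>, both error terms are absorbed when \<open>\<epsilon> \<le> 1/4\<close>,
  leaving \<open>\<nu> \<parallel>w\<parallel>\<^sup>2 \<le> 4 \<bar>\<langle>F, \<phi>\<rangle>\<bar>\<close>. The elliptic bounds \<open>k\<^sup>2 \<parallel>\<phi>\<parallel> \<le> \<parallel>w\<parallel>\<close> and \<open>\<bar>k\<bar> \<parallel>u\<parallel> \<le> \<parallel>w\<parallel>\<close> then give
  the two cases.

  The equation only holds against test functions, so the pairing is a limit: \<open>\<phi>''\<close> is approximated in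
  \<open>L\<^sup>2\<close> by test functions, which are corrected to have vanishing zeroth and first moments and then
  integrated twice.
\<close>

section \<open>\<open>L\<^sup>2\<close> on the interval\<close>

text \<open>The difficulty is one of regularity. The energy identity is therefore proved only for
  test functions, where everything is classical, and carried over by a bilinear form
  (\<open>OS_form\<close>) that puts every remaining derivative on the test function. Replacing
  \<open>w\<close> by the vorticity of an approximant costs an error linear in their
  \<open>L2\<close> distance; its coefficient may depend on \<lambda>, since the error tends to 0.
  The correction of moments is forced by the boundary conditions: for a clamped function the mean
  and the first moment of the second derivative vanish, which is exactly what lets a twofold
  primitive of a compactly supported function be compactly supported again. Since the pairing of
  distributions is bilinear, conjugates are inserted by hand. As for the constants: the shear uses
  up one half and the \<epsilon> term one quarter of the viscous term, whence 1/4 and 4.\<close>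

abbreviation \<mu> :: "real measure" where
  "\<mu> \<equiv> lebesgue_on I"

lemma finite_measure_interval: "finite_measure \<mu>"
  by (rule finite_measure_lebesgue_on) auto

lemma measure_interval: "measure \<mu> I = 2"
  by (simp add: measure_restrict_space)

lemma L2_measurable [measurable_dest]: "f \<in> L2 \<Longrightarrow> f \<in> borel_measurable \<mu>"
  by (simp add: L2_def)

lemma L2_integrable_square: "f \<in> L2 \<Longrightarrow> integrable \<mu> (\<lambda>y. (cmod (f y))\<^sup>2)"
  by (simp add: L2_def)

lemma L2_I:
  assumes [measurable]: "f \<in> borel_measurable \<mu>"
    and "integrable \<mu> g" "AE y in \<mu>. (cmod (f y))\<^sup>2 \<le> g y"
  shows "f \<in> L2"
  unfolding L2_def
proof (intro CollectI conjI assms(1))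
  show "integrable \<mu> (\<lambda>y. (cmod (f y))\<^sup>2)"
    by (rule Bochner_Integration.integrable_bound[OF assms(2)])
      (use assms(3) in \<open>auto elim: eventually_mono\<close>)
qed

lemma L2_norm_nonneg [simp]: "L2_norm f \<ge> 0"
  by (simp add: L2_norm_def)

lemma L2_norm_square: "(L2_norm f)\<^sup>2 = (\<integral>y. (cmod (f y))\<^sup>2 \<partial>\<mu>)"
  by (simp add: L2_norm_def)

lemma L2_add [intro]:
  assumes "f \<in> L2" "g \<in> L2"
  shows "(\<lambda>y. f y + g y) \<in> L2"
proof (rule L2_I)
  show "(\<lambda>y. f y + g y) \<in> borel_measurable \<mu>"
    using assms by (intro borel_measurable_add L2_measurable)
  show "integrable \<mu> (\<lambda>y. 2 * (cmod (f y))\<^sup>2 + 2 * (cmod (g y))\<^sup>2)"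
    using assms by (intro Bochner_Integration.integrable_add integrable_mult_right L2_integrable_square)
  have "(cmod (a + b))\<^sup>2 \<le> 2 * (cmod a)\<^sup>2 + 2 * (cmod b)\<^sup>2" for a b :: complex
  proof -
    have "(cmod (a + b))\<^sup>2 \<le> (cmod a + cmod b)\<^sup>2"
      by (intro power_mono norm_triangle_ineq norm_ge_zero)
    also have "\<dots> \<le> 2 * (cmod a)\<^sup>2 + 2 * (cmod b)\<^sup>2"
      using zero_le_power2[of "cmod a - cmod b"] by (simp add: power2_eq_square algebra_simps)
    finally show ?thesis .
  qed
  then show "AE y in \<mu>. (cmod (f y + g y))\<^sup>2 \<le> 2 * (cmod (f y))\<^sup>2 + 2 * (cmod (g y))\<^sup>2"
    by simp
qed

lemma L2_mult_bounded:
  assumes f: "f \<in> L2" and a: "a \<in> borel_measurable \<mu>"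
    and c: "\<And>y. y \<in> I \<Longrightarrow> cmod (a y) \<le> c"
  shows "(\<lambda>y. a y * f y) \<in> L2" and "L2_norm (\<lambda>y. a y * f y) \<le> c * L2_norm f"
proof -
  have "c \<ge> 0" using c[of 0] by (meson norm_ge_zero order_trans greaterThanLessThan_iff neg_less_0_iff_less zero_less_one)
  have le: "(cmod (a y * f y))\<^sup>2 \<le> c\<^sup>2 * (cmod (f y))\<^sup>2" if "y \<in> I" for y
    unfolding norm_mult power_mult_distrib using c[OF that] by (intro mult_right_mono power_mono) auto
  have int: "integrable \<mu> (\<lambda>y. c\<^sup>2 * (cmod (f y))\<^sup>2)"
    using f by (intro integrable_mult_right L2_integrable_square)
  show L: "(\<lambda>y. a y * f y) \<in> L2"
    by (rule L2_I[OF _ int]) (use f a le in \<open>auto intro!: borel_measurable_times L2_measurable\<close>)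
  have "(\<integral>y. (cmod (a y * f y))\<^sup>2 \<partial>\<mu>) \<le> (\<integral>y. c\<^sup>2 * (cmod (f y))\<^sup>2 \<partial>\<mu>)"
    by (rule integral_mono[OF L2_integrable_square[OF L] int]) (use le in simp)
  then have "(L2_norm (\<lambda>y. a y * f y))\<^sup>2 \<le> (c * L2_norm f)\<^sup>2"
    by (simp add: L2_norm_square power_mult_distrib)
  then show "L2_norm (\<lambda>y. a y * f y) \<le> c * L2_norm f"
    by (rule power2_le_imp_le) (use \<open>c \<ge> 0\<close> in simp)
qed

lemma L2_scale [intro]: "f \<in> L2 \<Longrightarrow> (\<lambda>y. c * f y) \<in> L2"
  by (rule L2_mult_bounded[where c = "cmod c"]) auto

lemma L2_norm_scale: "L2_norm (\<lambda>y. c * f y) = cmod c * L2_norm f"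
  by (simp add: L2_norm_def norm_mult power_mult_distrib real_sqrt_mult)

lemma L2_uminus [intro]: "f \<in> L2 \<Longrightarrow> (\<lambda>y. - f y) \<in> L2"
  using L2_scale[of f "-1"] by simp

lemma L2_diff [intro]: "f \<in> L2 \<Longrightarrow> g \<in> L2 \<Longrightarrow> (\<lambda>y. f y - g y) \<in> L2"
  using L2_add[of f "\<lambda>y. - g y"] L2_uminus[of g] by simp

lemma L2_cnj [intro]: "f \<in> L2 \<Longrightarrow> (\<lambda>y. cnj (f y)) \<in> L2"
  by (auto simp: L2_def intro: borel_measurable_continuous_on[where f = cnj] continuous_intros)

lemma L2_norm_cnj: "L2_norm (\<lambda>y. cnj (f y)) = L2_norm f"
  by (simp add: L2_norm_def)

lemma L2_norm_minus_commute: "L2_norm (\<lambda>y. f y - g y) = L2_norm (\<lambda>y. g y - f y)"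
  by (simp add: L2_norm_def norm_minus_commute)

lemma integrable_L2_mult:
  assumes "f \<in> L2" "g \<in> L2"
  shows "integrable \<mu> (\<lambda>y. f y * g y)"
proof (rule Bochner_Integration.integrable_bound)
  show "integrable \<mu> (\<lambda>y. (cmod (f y))\<^sup>2 + (cmod (g y))\<^sup>2)"
    using assms by (intro Bochner_Integration.integrable_add L2_integrable_square)
  show "(\<lambda>y. f y * g y) \<in> borel_measurable \<mu>"
    using assms by (intro borel_measurable_times L2_measurable)
  have "cmod (a * b) \<le> (cmod a)\<^sup>2 + (cmod b)\<^sup>2" for a b
    using sum_squares_bound[of "cmod a" "cmod b"] mult_nonneg_nonneg[OF norm_ge_zero[of a] norm_ge_zero[of b]]
    unfolding norm_mult by linarith
  then show "AE y in \<mu>. norm (f y * g y) \<le> norm ((cmod (f y))\<^sup>2 + (cmod (g y))\<^sup>2)"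
    by simp
qed

text \<open>Evaluate at the minimiser \<open>t = b / c\<close>; if \<open>c = 0\<close>, the
  expression is affine in \<open>t\<close> and stays nonnegative only when its slope vanishes. This
  is the algebra behind Cauchy-Schwarz.\<close>

lemma nonneg_quadratic_discriminant:
  fixes a b c :: real
  assumes "\<And>t. 0 \<le> a - 2 * t * b + t\<^sup>2 * c" "a \<ge> 0" "c \<ge> 0"
  shows "b\<^sup>2 \<le> a * c"
proof (cases "c = 0")
  case True
  have "b = 0"
  proof (rule ccontr)
    assume "b \<noteq> 0"
    then have "a - 2 * ((a + 1) / b) * b + ((a + 1) / b)\<^sup>2 * c = - a - 2"
      using True by simp
    then show False using assms(1)[of "(a + 1) / b"] assms(2) by linarith
  qed
  then show ?thesis using True by simp
next
  case False
  then have "c > 0" using assms by simp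
  have "a - 2 * (b / c) * b + (b / c)\<^sup>2 * c = a - b\<^sup>2 / c"
    using False by (simp add: power2_eq_square field_simps)
  then have "b\<^sup>2 / c \<le> a" using assms(1)[of "b / c"] by linarith
  then show ?thesis using \<open>c > 0\<close> by (simp add: divide_le_eq)
qed

text \<open>The quadratic in \<open>t\<close> is the integral of
  \<open>(cmod f - t * cmod g)\<^sup>2\<close>. The modulus stands inside the integral because the
  triangle inequality needs this stronger form.\<close>

lemma L2_Cauchy_Schwarz_norm:
  assumes "f \<in> L2" "g \<in> L2"
  shows "(\<integral>y. cmod (f y * g y) \<partial>\<mu>) \<le> L2_norm f * L2_norm g"
proof -
  let ?b = "\<integral>y. cmod (f y * g y) \<partial>\<mu>"
  note int = integrable_norm[OF integrable_L2_mult[OF assms]] L2_integrable_square[OF assms(1)]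
    L2_integrable_square[OF assms(2)]
  have "0 \<le> (L2_norm f)\<^sup>2 - 2 * t * ?b + t\<^sup>2 * (L2_norm g)\<^sup>2" for t
  proof -
    have "0 \<le> (\<integral>y. (cmod (f y) - t * cmod (g y))\<^sup>2 \<partial>\<mu>)"
      by (rule integral_nonneg_AE) simp
    also have "\<dots> = (\<integral>y. (cmod (f y))\<^sup>2 - 2 * t * cmod (f y * g y) + t\<^sup>2 * (cmod (g y))\<^sup>2 \<partial>\<mu>)"
      by (rule Bochner_Integration.integral_cong) (auto simp: power2_eq_square algebra_simps norm_mult)
    also have "\<dots> = (L2_norm f)\<^sup>2 - 2 * t * ?b + t\<^sup>2 * (L2_norm g)\<^sup>2"
      using int by (simp add: L2_norm_square)
    finally show ?thesis .
  qed
  then have "?b\<^sup>2 \<le> (L2_norm f)\<^sup>2 * (L2_norm g)\<^sup>2"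
    by (rule nonneg_quadratic_discriminant) auto
  then have "?b\<^sup>2 \<le> (L2_norm f * L2_norm g)\<^sup>2"
    by (simp add: power_mult_distrib)
  then show ?thesis
    by (rule power2_le_imp_le) simp
qed

lemma L2_Cauchy_Schwarz:
  assumes "f \<in> L2" "g \<in> L2"
  shows "cmod (\<integral>y. f y * g y \<partial>\<mu>) \<le> L2_norm f * L2_norm g"
  using integral_norm_bound[of \<mu> "\<lambda>y. f y * g y"] L2_Cauchy_Schwarz_norm[OF assms] by linarith

lemma L2_norm_triangle:
  assumes "f \<in> L2" "g \<in> L2"
  shows "L2_norm (\<lambda>y. f y + g y) \<le> L2_norm f + L2_norm g"
proof (rule power2_le_imp_le)
  note int = integrable_norm[OF integrable_L2_mult[OF assms]] L2_integrable_square[OF assms(1)]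
    L2_integrable_square[OF assms(2)]
  have "(L2_norm (\<lambda>y. f y + g y))\<^sup>2
      \<le> (\<integral>y. (cmod (f y))\<^sup>2 + 2 * cmod (f y * g y) + (cmod (g y))\<^sup>2 \<partial>\<mu>)"
    unfolding L2_norm_square
  proof (rule integral_mono[OF L2_integrable_square])
    show "(\<lambda>y. f y + g y) \<in> L2" using assms by auto
    show "integrable \<mu> (\<lambda>y. (cmod (f y))\<^sup>2 + 2 * cmod (f y * g y) + (cmod (g y))\<^sup>2)"
      using int by simp
    show "(cmod (f y + g y))\<^sup>2 \<le> (cmod (f y))\<^sup>2 + 2 * cmod (f y * g y) + (cmod (g y))\<^sup>2" for y
    proof -
      have "(cmod (f y + g y))\<^sup>2 \<le> (cmod (f y) + cmod (g y))\<^sup>2"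
        by (intro power_mono norm_triangle_ineq norm_ge_zero)
      then show ?thesis by (simp add: power2_eq_square algebra_simps norm_mult)
    qed
  qed
  also have "\<dots> = (L2_norm f)\<^sup>2 + 2 * (\<integral>y. cmod (f y * g y) \<partial>\<mu>) + (L2_norm g)\<^sup>2"
    using int by (simp add: L2_norm_square)
  also have "\<dots> \<le> (L2_norm f + L2_norm g)\<^sup>2"
    using L2_Cauchy_Schwarz_norm[OF assms] by (simp add: power2_sum)
  finally show "(L2_norm (\<lambda>y. f y + g y))\<^sup>2 \<le> (L2_norm f + L2_norm g)\<^sup>2" .
qed simp

lemma L2_norm_triangle_diff:
  assumes "f \<in> L2" "g \<in> L2" "h \<in> L2"
  shows "L2_norm (\<lambda>y. f y - h y) \<le> L2_norm (\<lambda>y. f y - g y) + L2_norm (\<lambda>y. g y - h y)"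
  using L2_norm_triangle[OF L2_diff[OF assms(1,2)] L2_diff[OF assms(2,3)]] by simp

lemma L2_norm_le_diff:
  assumes "f \<in> L2" "g \<in> L2"
  shows "L2_norm f \<le> L2_norm g + L2_norm (\<lambda>y. f y - g y)"
  using L2_norm_triangle[OF assms(2) L2_diff[OF assms]] by simp

lemma L2_norm_tendsto:
  assumes "f \<in> L2" "\<And>n. g n \<in> L2" "(\<lambda>n. L2_norm (\<lambda>y. f y - g n y)) \<longlonglongrightarrow> 0"
  shows "(\<lambda>n. L2_norm (g n)) \<longlonglongrightarrow> L2_norm f"
proof (rule Lim_transform[OF tendsto_const])
  show "(\<lambda>n. L2_norm (g n) - L2_norm f) \<longlonglongrightarrow> 0"
  proof (rule Lim_null_comparison[OF _ assms(3)])
    show "\<forall>\<^sub>F n in sequentially. norm (L2_norm (g n) - L2_norm f) \<le> L2_norm (\<lambda>y. f y - g n y)"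
      using L2_norm_le_diff[OF assms(1,2)] L2_norm_le_diff[OF assms(2,1)]
      by (auto simp: abs_le_iff L2_norm_minus_commute[of _ f] algebra_simps)
  qed
qed

lemma L2_bounded:
  assumes "f \<in> borel_measurable \<mu>" "\<And>y. y \<in> I \<Longrightarrow> cmod (f y) \<le> c"
  shows "f \<in> L2" and "L2_norm f \<le> sqrt 2 * c"
proof -
  interpret finite_measure \<mu> by (rule finite_measure_interval)
  have one: "(\<lambda>_. 1) \<in> L2" by (rule L2_I[where g = "\<lambda>_. 1"]) auto
  show "f \<in> L2" using L2_mult_bounded(1)[OF one assms] by simp
  have "L2_norm (\<lambda>_. 1) = sqrt 2" by (simp add: L2_norm_def measure_interval)
  then show "L2_norm f \<le> sqrt 2 * c"
    using L2_mult_bounded(2)[OF one assms] by (simp add: mult.commute)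
qed

lemma L2_const [simp, intro]: "(\<lambda>_. c) \<in> L2"
  by (rule L2_bounded) auto

lemma L2_norm_const: "L2_norm (\<lambda>_. c) = sqrt 2 * cmod c"
  by (simp add: L2_norm_def measure_interval real_sqrt_mult)

lemma integrable_L2: "f \<in> L2 \<Longrightarrow> integrable \<mu> f"
  using integrable_L2_mult[of f "\<lambda>_. 1"] by simp

lemma norm_integral_le: "f \<in> L2 \<Longrightarrow> cmod (\<integral>y. f y \<partial>\<mu>) \<le> sqrt 2 * L2_norm f"
  using L2_Cauchy_Schwarz[of f "\<lambda>_. 1"] by (simp add: L2_norm_const mult.commute)

lemma L2_norm_cong_AE:
  assumes "f \<in> borel_measurable \<mu>" "g \<in> borel_measurable \<mu>" "AE y in \<mu>. f y = g y"
  shows "L2_norm f = L2_norm g"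
  unfolding L2_norm_def using assms
  by (intro arg_cong[where f = sqrt] integral_cong_AE) (auto elim: eventually_mono)

lemma L2_norm_eq_0_iff:
  assumes "f \<in> L2"
  shows "L2_norm f = 0 \<longleftrightarrow> (AE y in \<mu>. f y = 0)"
  using integral_nonneg_eq_0_iff_AE[OF L2_integrable_square[OF assms]] by (simp add: L2_norm_def)

section \<open>Continuous functions on the closed interval: integrals and endpoint values\<close>

lemma continuous_measurable: "continuous_on {-1..1} f \<Longrightarrow> f \<in> borel_measurable \<mu>"
  by (rule continuous_imp_measurable_on_sets_lebesgue) (auto intro: continuous_on_subset)

lemma continuous_bounded:
  fixes f :: "real \<Rightarrow> complex"
  assumes "continuous_on {-1..1} f"
  obtains c where "c > 0" "\<And>y. y \<in> {-1..1} \<Longrightarrow> cmod (f y) \<le> c"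
  using compact_imp_bounded[OF compact_continuous_image[OF assms compact_Icc]]
  unfolding bounded_pos by auto

lemma L2_continuous:
  assumes "continuous_on {-1..1} f"
  shows "f \<in> L2"
proof -
  obtain c where "\<And>y. y \<in> {-1..1} \<Longrightarrow> cmod (f y) \<le> c" using continuous_bounded[OF assms] by metis
  then show ?thesis using continuous_measurable[OF assms] by (intro L2_bounded(1)[where c = c]) auto
qed

text \<open>Bridge from the Lebesgue integral on the open interval to the gauge integral on the
  closed one, where the fundamental theorem of calculus lives; the endpoints are a null set.\<close>

lemma integral_interval_eq:
  fixes f :: "real \<Rightarrow> 'a::euclidean_space"
  assumes "integrable \<mu> f"
  shows "(\<integral>y. f y \<partial>\<mu>) = integral {-1..1} f"
  using lebesgue_integral_eq_integral[OF assms] by (simp add: integral_open_interval_real)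

lemma FTC_interval:
  fixes F f :: "real \<Rightarrow> complex"
  assumes "\<And>y. y \<in> {-1..1} \<Longrightarrow> (F has_vector_derivative f y) (at y)" "continuous_on {-1..1} f"
  shows "(\<integral>y. f y \<partial>\<mu>) = F 1 - F (-1)"
proof -
  have "(f has_integral (F 1 - F (-1))) {-1..1}"
    using assms(1) by (intro fundamental_theorem_of_calculus) (auto intro: has_vector_derivative_at_within)
  then show ?thesis
    using integral_interval_eq[OF integrable_L2[OF L2_continuous[OF assms(2)]]]
    by (simp add: integral_unique)
qed

text \<open>The integral of the continuous function \<open>cmod (f y - c)\<close> vanishes, so the
  function vanishes everywhere, endpoints included. This allows identities known only almost
  everywhere to be evaluated at the boundary.\<close>

lemma continuous_AE_const:
  fixes f :: "real \<Rightarrow> complex"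
  assumes "continuous_on {-1..1} f" "AE y in \<mu>. f y = c" "x \<in> {-1..1}"
  shows "f x = c"
proof -
  let ?h = "\<lambda>y. cmod (f y - c)"
  have ch: "continuous_on {-1..1} ?h" using assms(1) by (intro continuous_intros)
  have "integrable \<mu> ?h"
    using assms(1) by (intro integrable_norm integrable_L2 L2_continuous continuous_intros)
  then have "integral {-1..1} ?h = (\<integral>y. ?h y \<partial>\<mu>)"
    by (simp add: integral_interval_eq)
  also have "\<dots> = (\<integral>y. 0 \<partial>\<mu>)"
    using assms(2) \<open>integrable \<mu> ?h\<close> by (intro integral_cong_AE) (auto elim: eventually_mono)
  finally have "integral {-1..1} ?h = 0" by simp
  with integral_eq_0_iff[OF ch] assms(3) show ?thesis by force
qed

lemma L2_dominated_convergence: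
  assumes f: "f \<in> borel_measurable \<mu>" and s: "\<And>n. s n \<in> borel_measurable \<mu>"
    and lim: "AE y in \<mu>. (\<lambda>n. s n y) \<longlonglongrightarrow> f y"
    and G: "integrable \<mu> G"
    and dom: "\<And>n. AE y in \<mu>. (cmod (f y - s n y))\<^sup>2 \<le> G y"
  shows "(\<lambda>n. L2_norm (\<lambda>y. f y - s n y)) \<longlonglongrightarrow> 0"
proof -
  have "(\<lambda>n. \<integral>y. (cmod (f y - s n y))\<^sup>2 \<partial>\<mu>) \<longlonglongrightarrow> (\<integral>y. 0 \<partial>\<mu>)"
  proof (rule integral_dominated_convergence[OF _ _ G])
    show "AE y in \<mu>. (\<lambda>n. (cmod (f y - s n y))\<^sup>2) \<longlonglongrightarrow> 0"
      using lim
    proof eventually_elim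
      case (elim y)
      from tendsto_power[OF tendsto_norm[OF tendsto_diff[OF tendsto_const[of "f y"] elim]], of 2]
      show ?case by simp
    qed
  qed (use f s dom in auto)
  then show ?thesis
    unfolding L2_norm_def using tendsto_real_sqrt by force
qed

section \<open>Smooth functions\<close>

definition smooth :: "(real \<Rightarrow> complex) \<Rightarrow> bool" where
  "smooth f \<longleftrightarrow> (\<forall>n y. (D ^^ n) f differentiable (at y))"

text \<open>If \<open>S\<close> is closed under differentiation, every iterated derivative of a
  member stays in \<open>S\<close>. Exhibiting such an \<open>S\<close> replaces any formula for
  higher derivatives.\<close>

lemma smooth_coinduct:
  assumes "f \<in> S"
    and step: "\<And>g. g \<in> S \<Longrightarrow> \<exists>g'\<in>S. \<forall>y. (g has_vector_derivative g' y) (at y)"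
  shows "smooth f"
proof -
  have D_in: "D g \<in> S" if g: "g \<in> S" for g
  proof -
    obtain g' where g': "g' \<in> S" "\<forall>y. (g has_vector_derivative g' y) (at y)"
      using step[OF g] by blast
    then have "D g = g'" by (intro ext vector_derivative_at) auto
    then show ?thesis using g' by simp
  qed
  have in_S: "(D ^^ n) f \<in> S" for n
    by (induction n) (use assms(1) D_in in auto)
  show ?thesis
    unfolding smooth_def
  proof (intro allI)
    fix n y
    show "(D ^^ n) f differentiable (at y)"
      using step[OF in_S[of n]] differentiableI_vector by blast
  qed
qed

lemma smooth_deriv: "smooth f \<Longrightarrow> smooth (D f)"
  unfolding smooth_def
proof (intro allI)
  fix n y assume "\<forall>n y. (D ^^ n) f differentiable (at y)"
  then have "(D ^^ Suc n) f differentiable (at y)" by blast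
  then show "(D ^^ n) (D f) differentiable (at y)" by (simp add: funpow_Suc_right del: funpow.simps)
qed

lemma smooth_has_deriv: "smooth f \<Longrightarrow> (f has_vector_derivative D f y) (at y)"
  unfolding smooth_def vector_derivative_works[symmetric] by (drule spec[of _ 0]) simp

lemma smooth_continuous: "smooth f \<Longrightarrow> continuous_on S f"
  by (meson continuous_at_imp_continuous_on has_vector_derivative_continuous smooth_has_deriv)

text \<open>The derivative of each construction is again built by the rules, so the whole set can
  serve as the invariant in \<open>smooth_coinduct\<close>. The operations are treated together
  because a product differentiates to a sum of products.\<close>

inductive_set smooth_algebra :: "(real \<Rightarrow> complex) set" where
  base: "smooth f \<Longrightarrow> f \<in> smooth_algebra"
| poly: "polynomial_function f \<Longrightarrow> f \<in> smooth_algebra"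
| add: "f \<in> smooth_algebra \<Longrightarrow> g \<in> smooth_algebra \<Longrightarrow> (\<lambda>y. f y + g y) \<in> smooth_algebra"
| mult: "f \<in> smooth_algebra \<Longrightarrow> g \<in> smooth_algebra \<Longrightarrow> (\<lambda>y. f y * g y) \<in> smooth_algebra"
| cnj: "f \<in> smooth_algebra \<Longrightarrow> (\<lambda>y. cnj (f y)) \<in> smooth_algebra"
| affine: "f \<in> smooth_algebra \<Longrightarrow> (\<lambda>y. f (a * y + b)) \<in> smooth_algebra"

lemma polynomial_function_smooth_algebra [simp]:
  "(\<lambda>y::real. c) \<in> smooth_algebra" "complex_of_real \<in> smooth_algebra"
  by (auto intro!: smooth_algebra.poly polynomial_function_bounded_linear bounded_linear_of_real)

lemma smooth_algebra_smooth: "f \<in> smooth_algebra \<Longrightarrow> smooth f"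
proof (erule smooth_coinduct)
  fix g assume "g \<in> smooth_algebra"
  then show "\<exists>g'\<in>smooth_algebra. \<forall>y. (g has_vector_derivative g' y) (at y)"
  proof induction
    case (base f)
    then show ?case
      by (intro bexI[of _ "D f"]) (simp_all add: smooth_has_deriv smooth_deriv smooth_algebra.base)
  next
    case (poly f)
    then obtain f' where "polynomial_function f'" "\<And>y. (f has_vector_derivative f' y) (at y)"
      using has_vector_derivative_polynomial_function by blast
    then show ?case
      by (intro bexI[of _ f'] allI smooth_algebra.poly)
  next
    case (add f g)
    then obtain f' g' where "f' \<in> smooth_algebra" "g' \<in> smooth_algebra"
      "\<forall>y. (f has_vector_derivative f' y) (at y)" "\<forall>y. (g has_vector_derivative g' y) (at y)"
      by blast
    then show ?case
      by (intro bexI[of _ "\<lambda>y. f' y + g' y"]) (simp_all add: has_vector_derivative_add smooth_algebra.add)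
  next
    case (mult f g)
    then obtain f' g' where "f' \<in> smooth_algebra" "g' \<in> smooth_algebra"
      "\<forall>y. (f has_vector_derivative f' y) (at y)" "\<forall>y. (g has_vector_derivative g' y) (at y)"
      by blast
    then show ?case using mult.hyps
      by (intro bexI[of _ "\<lambda>y. f y * g' y + f' y * g y"])
        (simp_all add: has_vector_derivative_mult smooth_algebra.add smooth_algebra.mult)
  next
    case (cnj f)
    then obtain f' where "f' \<in> smooth_algebra" "\<forall>y. (f has_vector_derivative f' y) (at y)"
      by blast
    then show ?case
      by (intro bexI[of _ "\<lambda>y. cnj (f' y)"]) (simp_all add: has_vector_derivative_cnj smooth_algebra.cnj)
  next
    case (affine f a b)
    then obtain f' where f': "f' \<in> smooth_algebra" "\<forall>y. (f has_vector_derivative f' y) (at y)"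
      by blast
    have "((\<lambda>y. f (a * y + b)) has_vector_derivative of_real a * f' (a * y + b)) (at y)" for y
    proof -
      have "((\<lambda>y. a * y + b) has_vector_derivative a) (at y)"
        by (auto intro!: derivative_eq_intros)
      from vector_diff_chain_at[OF this f'(2)[rule_format]]
      show ?thesis by (simp add: o_def scaleR_conv_of_real)
    qed
    moreover have "(\<lambda>y. of_real a * f' (a * y + b)) \<in> smooth_algebra"
      using smooth_algebra.mult[OF _ smooth_algebra.affine[OF f'(1)], of "\<lambda>_. of_real a"] by simp
    ultimately show ?case
      by (intro bexI[of _ "\<lambda>y. of_real a * f' (a * y + b)"]) auto
  qed
qed

lemma smooth_const [simp]: "smooth (\<lambda>_. c)"
  by (rule smooth_algebra_smooth) simp

lemma smooth_of_real [simp]: "smooth complex_of_real"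
  by (rule smooth_algebra_smooth) simp

lemma smooth_polynomial: "polynomial_function f \<Longrightarrow> smooth f"
  by (rule smooth_algebra_smooth[OF smooth_algebra.poly])

lemma smooth_add: "smooth f \<Longrightarrow> smooth g \<Longrightarrow> smooth (\<lambda>y. f y + g y)"
  by (rule smooth_algebra_smooth[OF smooth_algebra.add[OF smooth_algebra.base smooth_algebra.base]])

lemma smooth_mult: "smooth f \<Longrightarrow> smooth g \<Longrightarrow> smooth (\<lambda>y. f y * g y)"
  by (rule smooth_algebra_smooth[OF smooth_algebra.mult[OF smooth_algebra.base smooth_algebra.base]])

lemma smooth_cnj: "smooth f \<Longrightarrow> smooth (\<lambda>y. cnj (f y))"
  by (rule smooth_algebra_smooth[OF smooth_algebra.cnj[OF smooth_algebra.base]])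

lemma smooth_affine: "smooth f \<Longrightarrow> smooth (\<lambda>y. f (a * y + b))"
  by (rule smooth_algebra_smooth[OF smooth_algebra.affine[OF smooth_algebra.base]])

lemma smooth_diff: "smooth f \<Longrightarrow> smooth g \<Longrightarrow> smooth (\<lambda>y. f y - g y)"
  using smooth_add[of f "\<lambda>y. (-1) * g y"] smooth_mult[of "\<lambda>_. -1" g] by simp

text \<open>
  The family \<open>p(1/x) exp(-1/x)\<close>, extended by zero to \<open>x \<le> 0\<close>, is closed under differentiation, which
  makes all its members smooth at once.
\<close>

definition flat :: "real poly \<Rightarrow> real \<Rightarrow> complex" where
  "flat p x = (if x > 0 then of_real (poly p (1 / x) * exp (- (1 / x))) else 0)"

lemma tendsto_poly_exp_0: "((\<lambda>x. poly p x * exp (- x)) \<longlongrightarrow> (0::real)) at_top"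
proof -
  have "((\<lambda>x. coeff p i * (x ^ i / exp x)) \<longlongrightarrow> 0) at_top" for i
    using tendsto_mult_right_zero[OF tendsto_power_div_exp_0] .
  then have "((\<lambda>x. \<Sum>i\<le>degree p. coeff p i * (x ^ i / exp x)) \<longlongrightarrow> 0) at_top"
    by (rule tendsto_null_sum)
  moreover have "(\<Sum>i\<le>degree p. coeff p i * (x ^ i / exp x)) = poly p x * exp (- x)" for x
    unfolding poly_altdef sum_distrib_right exp_minus by (simp add: divide_inverse mult.assoc)
  ultimately show ?thesis by simp
qed

lemma flat_tendsto_0: "(flat p \<longlongrightarrow> 0) (at 0)"
proof -
  have "((\<lambda>x. poly p (1 / x) * exp (- (1 / x))) \<longlongrightarrow> 0) (at_right 0)"
    using filterlim_compose[OF tendsto_poly_exp_0 filterlim_inverse_at_top_right, of p]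
    unfolding inverse_eq_divide .
  then have "((\<lambda>x. complex_of_real (poly p (1 / x) * exp (- (1 / x)))) \<longlongrightarrow> of_real 0) (at_right 0)"
    by (rule tendsto_of_real)
  moreover have "\<forall>\<^sub>F x in at_right 0. complex_of_real (poly p (1 / x) * exp (- (1 / x))) = flat p x"
    by (rule eventually_mono[OF eventually_at_right_less[of 0]]) (simp add: flat_def)
  ultimately have "(flat p \<longlongrightarrow> of_real 0) (at_right 0)"
    by (rule Lim_transform_eventually)
  moreover have "\<forall>\<^sub>F x in at_left 0. flat p x = 0"
    by (rule eventually_at_leftI[of "-1"]) (simp_all add: flat_def)
  then have "(flat p \<longlongrightarrow> 0) (at_left 0)"
    by (rule tendsto_eventually)
  ultimately show ?thesis
    by (simp add: filterlim_split_at)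
qed

text \<open>With u = 1/x one has d/dx = - u^2 d/du, which sends p(u) exp(-u) to u^2 (p(u) - p'(u))
  exp(-u); hence the polynomial on the right.\<close>

lemma flat_has_deriv:
  "(flat p has_vector_derivative flat ([:0, 0, 1:] * (p - pderiv p)) x) (at x)"
proof -
  let ?q = "[:0, 0, 1:] * (p - pderiv p)"
  consider "x < 0" | "x = 0" | "x > 0" by linarith
  then show ?thesis
  proof cases
    case 1
    have "(flat p has_vector_derivative 0) (at x)"
      by (rule has_vector_derivative_transform_within_open[of "\<lambda>_. 0" _ _ "{..<0}"])
        (use 1 in \<open>simp_all add: flat_def\<close>)
    then show ?thesis using 1 by (simp add: flat_def)
  next
    case 2
    \<comment> \<open>At the origin the difference quotient has the modulus of another flat
      function, because dividing by \<open>h\<close> multiplies the polynomial in 1/h by its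
      variable; flat functions tend to 0.\<close>
    have "(\<lambda>h. norm (flat p (0 + h) - flat p 0 - h *\<^sub>R 0) / norm h) = (\<lambda>h. norm (flat ([:0, 1:] * p) h))"
      by (intro ext) (simp add: flat_def norm_mult norm_divide abs_mult)
    then have "((\<lambda>h. norm (flat p (0 + h) - flat p 0 - h *\<^sub>R 0) / norm h) \<longlongrightarrow> 0) (at 0)"
      using tendsto_norm_zero[OF flat_tendsto_0[of "[:0, 1:] * p"]] by presburger
    then have "(flat p has_vector_derivative 0) (at 0)"
      unfolding has_vector_derivative_def has_derivative_at by simp
    then show ?thesis using 2 by (simp add: flat_def)
  next
    case 3
    have "((\<lambda>x. poly p (1 / x) * exp (- (1 / x))) has_real_derivative
        (- (1 / x\<^sup>2) * poly (pderiv p) (1 / x)) * exp (- (1 / x))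
          + (exp (- (1 / x)) * (1 / x\<^sup>2)) * poly p (1 / x)) (at x)"
    proof (rule DERIV_mult)
      have inv: "((\<lambda>x. 1 / x) has_real_derivative - (1 / x\<^sup>2)) (at x)"
        using 3 by (auto intro!: derivative_eq_intros simp: power2_eq_square)
      show "((\<lambda>x. poly p (1 / x)) has_real_derivative - (1 / x\<^sup>2) * poly (pderiv p) (1 / x)) (at x)"
        using DERIV_chain2[OF poly_DERIV inv] by (simp add: mult.commute)
      show "((\<lambda>x. exp (- (1 / x))) has_real_derivative exp (- (1 / x)) * (1 / x\<^sup>2)) (at x)"
        using DERIV_fun_exp[OF DERIV_minus[OF inv]] by simp
    qed
    moreover have "(- (1 / x\<^sup>2) * poly (pderiv p) (1 / x)) * exp (- (1 / x))
          + (exp (- (1 / x)) * (1 / x\<^sup>2)) * poly p (1 / x) = poly ?q (1 / x) * exp (- (1 / x))"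
      by (simp add: power2_eq_square algebra_simps)
    ultimately have "((\<lambda>x. poly p (1 / x) * exp (- (1 / x))) has_real_derivative
        poly ?q (1 / x) * exp (- (1 / x))) (at x)"
      by simp
    then have "((\<lambda>x. complex_of_real (poly p (1 / x) * exp (- (1 / x)))) has_vector_derivative
        of_real (poly ?q (1 / x) * exp (- (1 / x)))) (at x)"
      by (intro has_vector_derivative_of_real) (simp only: has_real_derivative_iff_has_vector_derivative)
    then have "(flat p has_vector_derivative of_real (poly ?q (1 / x) * exp (- (1 / x)))) (at x)"
      by (rule has_vector_derivative_transform_within_open[of _ _ _ "{0<..}"])
        (use 3 in \<open>simp_all add: flat_def\<close>)
    then show ?thesis using 3 by (simp add: flat_def)
  qed
qed

lemma smooth_flat: "smooth (flat p)"
proof (rule smooth_coinduct[of _ "range flat"])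
  fix g assume "g \<in> range flat"
  then obtain q where "g = flat q" by blast
  then show "\<exists>g'\<in>range flat. \<forall>y. (g has_vector_derivative g' y) (at y)"
    by (intro bexI[of _ "flat ([:0, 0, 1:] * (q - pderiv q))"]) (simp_all only: flat_has_deriv rangeI simp_thms)
qed simp

section \<open>Density of test functions\<close>

lemma test_functions_I:
  assumes "smooth \<psi>" "r < 1" "\<And>y. r < \<bar>y\<bar> \<Longrightarrow> \<psi> y = 0"
  shows "\<psi> \<in> test_functions"
  unfolding test_functions_def
proof (intro CollectI conjI exI[of _ "{- r..r}"])
  show "\<forall>n y. (D ^^ n) \<psi> differentiable (at y)" using assms(1) by (simp add: smooth_def)
  show "compact {- r..r}" "{- r..r} \<subseteq> I" using assms(2) by auto
  show "\<forall>y. y \<notin> {- r..r} \<longrightarrow> \<psi> y = 0" using assms(3) by (auto simp: abs_le_iff not_le)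
qed

text \<open>A compact set inside the open interval stays away from the endpoints, so the support
  condition reduces to one radius \<open>r < 1\<close>; supports are then handled by comparing
  radii.\<close>

lemma test_functions_E:
  assumes "\<psi> \<in> test_functions"
  obtains r where "0 \<le> r" "r < 1" "\<And>y. r < \<bar>y\<bar> \<Longrightarrow> \<psi> y = 0"
proof -
  obtain K where K: "compact K" "K \<subseteq> I" "\<And>y. y \<notin> K \<Longrightarrow> \<psi> y = 0"
    using assms by (auto simp: test_functions_def)
  show thesis
  proof (cases "K = {}")
    case True
    then show thesis using K(3) that[of 0] by auto
  next
    case False
    have "compact (abs ` K)"
      using K(1) by (intro compact_continuous_image continuous_intros)
    from compact_attains_sup[OF this] False
    obtain x where x: "x \<in> K" "\<And>y. y \<in> K \<Longrightarrow> \<bar>y\<bar> \<le> \<bar>x\<bar>" by auto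
    show thesis
    proof (rule that[of "\<bar>x\<bar>"])
      show "\<bar>x\<bar> < 1" using x(1) K(2) by (force simp: abs_less_iff)
      show "\<psi> y = 0" if "\<bar>x\<bar> < \<bar>y\<bar>" for y
        using x(2)[of y] K(3)[of y] that by (meson not_le)
    qed simp
  qed
qed

lemma test_functions_smooth: "\<psi> \<in> test_functions \<Longrightarrow> smooth \<psi>"
  by (simp add: test_functions_def smooth_def)

lemma test_functions_boundary: "\<psi> \<in> test_functions \<Longrightarrow> \<psi> 1 = 0" "\<psi> \<in> test_functions \<Longrightarrow> \<psi> (-1) = 0"
  by (erule test_functions_E, simp)+

lemma test_functions_mult:
  assumes "smooth a" "\<psi> \<in> test_functions"
  shows "(\<lambda>y. a y * \<psi> y) \<in> test_functions"
  using assms(2)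
proof (rule test_functions_E)
  fix r assume r: "0 \<le> r" "r < 1" "\<And>y. r < \<bar>y\<bar> \<Longrightarrow> \<psi> y = 0"
  show ?thesis
    by (rule test_functions_I[OF smooth_mult[OF assms(1) test_functions_smooth[OF assms(2)]] r(2)])
      (simp add: r(3))
qed

lemma test_functions_scale: "\<psi> \<in> test_functions \<Longrightarrow> (\<lambda>y. c * \<psi> y) \<in> test_functions"
  by (rule test_functions_mult[OF smooth_const])

lemma test_functions_diff:
  assumes "\<psi> \<in> test_functions" "\<theta> \<in> test_functions"
  shows "(\<lambda>y. \<psi> y - \<theta> y) \<in> test_functions"
  using assms(1)
proof (rule test_functions_E)
  fix r assume r: "0 \<le> r" "r < 1" "\<And>y. r < \<bar>y\<bar> \<Longrightarrow> \<psi> y = 0"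
  from assms(2) show ?thesis
  proof (rule test_functions_E)
    fix s assume s: "0 \<le> s" "s < 1" "\<And>y. s < \<bar>y\<bar> \<Longrightarrow> \<theta> y = 0"
    show ?thesis
      by (rule test_functions_I[of _ "max r s"])
        (use assms r s in \<open>simp_all add: smooth_diff test_functions_smooth\<close>)
  qed
qed

lemma test_functions_cnj:
  assumes "\<psi> \<in> test_functions"
  shows "(\<lambda>y. cnj (\<psi> y)) \<in> test_functions"
  using assms
proof (rule test_functions_E)
  fix r assume r: "0 \<le> r" "r < 1" "\<And>y. r < \<bar>y\<bar> \<Longrightarrow> \<psi> y = 0"
  show ?thesis
    by (rule test_functions_I[OF smooth_cnj[OF test_functions_smooth[OF assms]] r(2)]) (simp add: r(3))
qed

lemma test_functions_deriv:
  assumes "\<psi> \<in> test_functions"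
  shows "D \<psi> \<in> test_functions"
  using assms
proof (rule test_functions_E)
  fix r assume r: "0 \<le> r" "r < 1" "\<And>y. r < \<bar>y\<bar> \<Longrightarrow> \<psi> y = 0"
  show ?thesis
  proof (rule test_functions_I[OF smooth_deriv[OF test_functions_smooth[OF assms]] r(2)])
    fix y :: real assume y: "r < \<bar>y\<bar>"
    have "open {y. r < \<bar>y::real\<bar>}"
      by (intro open_Collect_less continuous_intros)
    then have "(\<psi> has_vector_derivative 0) (at y)"
      by (rule has_vector_derivative_transform_within_open[of "\<lambda>_. 0", rotated]) (use y r(3) in auto)
    then show "D \<psi> y = 0" by (rule vector_derivative_at)
  qed
qed

lemma test_functions_L2: "\<psi> \<in> test_functions \<Longrightarrow> \<psi> \<in> L2"
  by (intro L2_continuous smooth_continuous test_functions_smooth)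

lemma antiderivative_UNIV:
  fixes f :: "real \<Rightarrow> complex"
  assumes "continuous_on UNIV f"
  obtains F where "\<And>y. (F has_vector_derivative f y) (at y)"
  using einterval_antiderivative[of "-\<infinity>" "\<infinity>" f] assms
  by (auto simp: continuous_on_eq_continuous_at)

text \<open>The primitive that vanishes at -1 is constant on each side of the support of
  \<open>h\<close>: zero on the left by choice, zero on the right because \<open>h\<close> has
  integral 0.\<close>

lemma test_functions_antideriv:
  assumes h: "h \<in> test_functions" and zero: "(\<integral>y. h y \<partial>\<mu>) = 0"
  obtains H where "H \<in> test_functions" "D H = h"
proof -
  have ch: "continuous_on S h" for S using smooth_continuous[OF test_functions_smooth[OF h]] .
  obtain F where F: "\<And>x. (F has_vector_derivative h x) (at x)"
    using antiderivative_UNIV[OF ch] by blast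
  define H where "H y = F y - F (-1)" for y
  have H: "(H has_vector_derivative h x) (at x)" for x
    using has_vector_derivative_diff[OF F has_vector_derivative_const[of "F (-1)"]] by (simp add: H_def[abs_def])
  have "H 1 = 0"
    using FTC_interval[OF F ch] zero by (simp add: H_def)
  obtain r where r: "0 \<le> r" "r < 1" "\<And>y. r < \<bar>y\<bar> \<Longrightarrow> h y = 0"
    using test_functions_E[OF h] by metis
  have const: "H y = H x" if "y \<in> S" "x \<in> S" "convex S" "\<And>y. y \<in> S \<Longrightarrow> h y = 0" for x y S
  proof -
    have "\<And>x. x \<in> S \<Longrightarrow> (H has_vector_derivative 0) (at x within S)"
      using H that(4) by (metis has_vector_derivative_at_within)
    from has_vector_derivative_zero_constant[OF that(3) this] that(1,2) show ?thesis by metis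
  qed
  have "smooth H"
  \<comment> \<open>\<open>H\<close> differentiates to \<open>h\<close>, so adjoining it to the
    smooth functions keeps the set closed under differentiation.\<close>
  proof (rule smooth_coinduct[of _ "insert H (Collect smooth)"])
    fix g assume "g \<in> insert H (Collect smooth)"
    then show "\<exists>g'\<in>insert H (Collect smooth). \<forall>y. (g has_vector_derivative g' y) (at y)"
    proof
      assume "g = H"
      then show ?thesis using H test_functions_smooth[OF h] by (intro bexI[of _ h]) auto
    next
      assume "g \<in> Collect smooth"
      then show ?thesis
        by (intro bexI[of _ "D g"]) (simp_all add: smooth_deriv smooth_has_deriv)
    qed
  qed simp
  moreover have "H y = 0" if "r < \<bar>y\<bar>" for y
  proof (cases "y < 0")
    case True
    then have "H y = H (-1)"
      using that r by (intro const[of _ "{..<-r}"]) auto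
    then show ?thesis by (simp add: H_def)
  next
    case False
    then have "H y = H 1"
      using that r by (intro const[of _ "{r<..}"]) auto
    then show ?thesis using \<open>H 1 = 0\<close> by simp
  qed
  ultimately have "H \<in> test_functions" using r(2) by (intro test_functions_I)
  moreover have "D H = h" using H vector_derivative_at by (intro ext) blast
  ultimately show thesis by (rule that)
qed

text \<open>\<open>flat 1\<close> is exp(-1/x) for positive x. For positive \<open>n\<close> the two
  factors vanish for y >= 1 - 1/n and for y <= -(1 - 1/n) respectively; at a point of the interval
  both arguments tend to infinity with \<open>n\<close>, so the cutoff tends to 1 pointwise although
  it has no plateau.\<close>

definition cutoff :: "nat \<Rightarrow> real \<Rightarrow> complex" where
  "cutoff n y = flat 1 (- real n * y + (real n - 1)) * flat 1 (real n * y + (real n - 1))"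

lemma norm_flat_one_le: "cmod (flat 1 x) \<le> 1"
  by (simp add: flat_def)

lemma cutoff_test_function: "n > 0 \<Longrightarrow> cutoff n \<in> test_functions"
proof (rule test_functions_I)
  show "smooth (cutoff n)"
    unfolding cutoff_def using smooth_flat by (intro smooth_mult smooth_affine)
  assume n: "n > 0"
  then show "1 - 1 / real n < 1" by simp
  fix y assume "1 - 1 / real n < \<bar>y\<bar>"
  then have "real n - 1 < real n * \<bar>y\<bar>" using n by (simp add: field_simps)
  then have "\<not> 0 < - real n * y + (real n - 1) \<or> \<not> 0 < real n * y + (real n - 1)"
    by (cases "y \<ge> 0") auto
  then show "cutoff n y = 0" by (auto simp: cutoff_def flat_def)
qed

lemma norm_cutoff_le: "cmod (cutoff n y) \<le> 1"
  unfolding cutoff_def norm_mult using norm_flat_one_le by (simp add: mult_le_one)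

lemma cutoff_tendsto:
  assumes "y \<in> I"
  shows "(\<lambda>n. cutoff n y) \<longlonglongrightarrow> 1"
proof -
  have lim: "(\<lambda>n. flat 1 (real n * t + (real n - 1))) \<longlonglongrightarrow> 1" if t: "t > -1" for t
  proof -
    have eq: "real n * t + (real n - 1) = - 1 + (1 + t) * real n" for n by (simp add: algebra_simps)
    have top: "filterlim (\<lambda>n. real n * t + (real n - 1)) at_top sequentially"
      unfolding eq using t
      by (intro filterlim_tendsto_add_at_top[OF tendsto_const] filterlim_tendsto_pos_mult_at_top[OF tendsto_const]
          filterlim_real_sequentially) auto
    have "(\<lambda>n. complex_of_real (exp (- (1 / (real n * t + (real n - 1)))))) \<longlonglongrightarrow> of_real (exp (- 0))"
      using tendsto_inverse_0_at_top[OF top] unfolding inverse_eq_divide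
      by (intro tendsto_of_real tendsto_exp tendsto_minus)
    then have lim': "(\<lambda>n. complex_of_real (exp (- (1 / (real n * t + (real n - 1)))))) \<longlonglongrightarrow> 1"
      by simp
    have "\<forall>\<^sub>F n in sequentially. 0 < real n * t + (real n - 1)"
      using top by (simp add: filterlim_at_top_dense)
    then have "\<forall>\<^sub>F n in sequentially. complex_of_real (exp (- (1 / (real n * t + (real n - 1)))))
        = flat 1 (real n * t + (real n - 1))"
      by eventually_elim (simp add: flat_def)
    with lim' show ?thesis by (rule Lim_transform_eventually)
  qed
  show ?thesis
    using tendsto_mult[OF lim[of "- y"] lim[of y]] assms by (simp add: cutoff_def)
qed

text \<open>For positive \<open>m\<close>, the radial retraction of the plane onto the disc of
  radius \<open>m\<close>. Unlike setting large values to 0, it is continuous, so clipped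
  approximants remain continuous.\<close>

definition clip :: "real \<Rightarrow> complex \<Rightarrow> complex" where
  "clip m z = of_real (m / max m (cmod z)) * z"

lemma norm_clip_le: "m > 0 \<Longrightarrow> cmod (clip m z) \<le> m"
proof -
  assume "m > 0"
  then have "m * cmod z \<le> m * max m (cmod z)" "max m (cmod z) > 0" by auto
  then show ?thesis using \<open>m > 0\<close> by (simp add: clip_def norm_mult norm_divide divide_le_eq)
qed

lemma clip_eq: "m > 0 \<Longrightarrow> cmod z \<le> m \<Longrightarrow> clip m z = z"
  by (simp add: clip_def max_absorb1)

lemma norm_diff_clip_le: "m > 0 \<Longrightarrow> cmod (z - clip m z) \<le> cmod z"
proof -
  assume m: "m > 0"
  define s where "s = m / max m (cmod z)"
  have s: "0 \<le> s" "s \<le> 1" using m by (auto simp: s_def divide_le_eq)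
  have "z - clip m z = of_real (1 - s) * z" by (simp add: clip_def s_def algebra_simps)
  then have "cmod (z - clip m z) = (1 - s) * cmod z"
    using s by (simp add: norm_mult del: of_real_diff)
  also have "\<dots> \<le> 1 * cmod z" using s by (intro mult_right_mono) auto
  finally show ?thesis by simp
qed

lemma continuous_on_clip: "m > 0 \<Longrightarrow> continuous_on S (clip m)"
  unfolding clip_def by (intro continuous_intros) auto

lemma L2_approx_clip:
  assumes f: "f \<in> L2" and e: "e > 0"
  obtains m where "m > 0" "L2_norm (\<lambda>y. f y - clip m (f y)) < e"
proof -
  have meas: "(\<lambda>y. clip (real (Suc n)) (f y)) \<in> borel_measurable \<mu>" for n
    using f continuous_on_clip[of "real (Suc n)" UNIV]
    by (intro borel_measurable_continuous_on[of "clip (real (Suc n))"]) auto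
  have "(\<lambda>n. L2_norm (\<lambda>y. f y - clip (real (Suc n)) (f y))) \<longlonglongrightarrow> 0"
  proof (rule L2_dominated_convergence[OF _ meas _ L2_integrable_square[OF f]])
    show "AE y in \<mu>. (\<lambda>n. clip (real (Suc n)) (f y)) \<longlonglongrightarrow> f y"
    proof (rule AE_I2)
      fix y
      obtain N where N: "cmod (f y) \<le> real N" using real_arch_simple by blast
      have "\<forall>\<^sub>F n in sequentially. clip (real (Suc n)) (f y) = f y"
        using eventually_ge_at_top[of N] by eventually_elim (use N in \<open>auto intro!: clip_eq\<close>)
      then show "(\<lambda>n. clip (real (Suc n)) (f y)) \<longlonglongrightarrow> f y" by (rule tendsto_eventually)
    qed
    show "AE y in \<mu>. (cmod (f y - clip (real (Suc n)) (f y)))\<^sup>2 \<le> (cmod (f y))\<^sup>2" for n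
      by (intro AE_I2 power_mono norm_diff_clip_le) auto
  qed (use f in auto)
  from order_tendstoD(2)[OF this e] obtain n where "L2_norm (\<lambda>y. f y - clip (real (Suc n)) (f y)) < e"
    using eventually_happens'[OF sequentially_bot] by blast
  then show thesis by (intro that[of "real (Suc n)"]) auto
qed

text \<open>A measurable function is an almost everywhere limit of continuous functions, but without
  a dominating function. Clipping both \<open>f\<close> and the approximants at level
  \<open>m\<close> bounds the differences by \<open>2 * m\<close>, which is enough on an interval of
  finite measure.\<close>

lemma L2_approx_continuous:
  assumes f: "f \<in> L2" and e: "e > 0"
  obtains g where "continuous_on UNIV g" "L2_norm (\<lambda>y. f y - g y) < e"
proof -
  obtain m where m: "m > 0" "L2_norm (\<lambda>y. f y - clip m (f y)) < e / 2"
    using L2_approx_clip[OF f, of "e / 2"] e by auto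
  define fm where "fm y = clip m (f y)" for y
  have fm_meas: "fm \<in> borel_measurable \<mu>"
    unfolding fm_def using f continuous_on_clip[OF m(1), of UNIV]
    by (intro borel_measurable_continuous_on[of "clip m"]) auto
  have fm_L2: "fm \<in> L2"
    by (rule L2_bounded(1)[OF fm_meas, of m]) (simp add: fm_def norm_clip_le m)
  \<comment> \<open>Extension by zero, because the almost everywhere approximation by continuous
    functions is taken on the whole line.\<close>
  have "(\<lambda>y. if y \<in> I then f y else 0) \<in> borel_measurable lebesgue"
    by (intro borel_measurable_if_I L2_measurable[OF f]) auto
  from lebesgue_measurable_imp_measurable_on[OF this, of UNIV]
  obtain N g where N: "negligible N" and cont: "\<And>n. continuous_on UNIV (g n)"
    and lim: "\<And>y. y \<notin> N \<Longrightarrow> (\<lambda>n. g n y) \<longlonglongrightarrow> (if y \<in> I then f y else 0)"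
    unfolding measurable_on_def by auto
  have cont': "continuous_on UNIV (\<lambda>y. clip m (g n y))" for n
    using continuous_on_compose2[OF continuous_on_clip[OF m(1), of UNIV] cont] by auto
  have "AE y in lebesgue. y \<notin> N"
    using N by (simp add: AE_not_in negligible_iff_null_sets)
  then have N': "AE y in \<mu>. y \<notin> N"
    by (subst AE_restrict_space_iff) (auto elim: eventually_mono)
  have "(\<lambda>n. L2_norm (\<lambda>y. fm y - clip m (g n y))) \<longlonglongrightarrow> 0"
  proof (rule L2_dominated_convergence[OF fm_meas, where G = "\<lambda>_. (2 * m)\<^sup>2"])
    show "(\<lambda>y. clip m (g n y)) \<in> borel_measurable \<mu>" for n
      using cont' continuous_on_subset by (blast intro: continuous_measurable)
    show "AE y in \<mu>. (\<lambda>n. clip m (g n y)) \<longlonglongrightarrow> fm y"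
      using N' AE_space
    proof eventually_elim
      case (elim y)
      then have "(\<lambda>n. g n y) \<longlonglongrightarrow> f y" using lim[of y] by simp
      then show ?case
        unfolding fm_def using continuous_on_tendsto_compose[OF continuous_on_clip[OF m(1), of UNIV]] by simp
    qed
    show "integrable \<mu> (\<lambda>_. (2 * m)\<^sup>2)"
      using finite_measure.integrable_const[OF finite_measure_interval] by blast
    show "AE y in \<mu>. (cmod (fm y - clip m (g n y)))\<^sup>2 \<le> (2 * m)\<^sup>2" for n
    proof (intro AE_I2 power_mono)
      fix y
      show "cmod (fm y - clip m (g n y)) \<le> 2 * m"
        using norm_triangle_ineq4[of "fm y" "clip m (g n y)"] norm_clip_le[OF m(1), of "f y"]
          norm_clip_le[OF m(1), of "g n y"] unfolding fm_def by linarith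
    qed simp
  qed
  from order_tendstoD(2)[OF this, of "e / 2"] e obtain n where n: "L2_norm (\<lambda>y. fm y - clip m (g n y)) < e / 2"
    using eventually_happens'[OF sequentially_bot] by fastforce
  have "(\<lambda>y. clip m (g n y)) \<in> L2"
    using cont' continuous_on_subset by (blast intro: L2_continuous)
  from L2_norm_triangle_diff[OF f fm_L2 this] n m(2)
  have "L2_norm (\<lambda>y. f y - clip m (g n y)) < e" unfolding fm_def by simp
  with cont' show thesis by (rule that)
qed

text \<open>Three successive approximations: a continuous function, a polynomial on the closed
  interval (for smoothness), and the polynomial times a cutoff (for compact support).\<close>

lemma L2_approx_test_function:
  assumes f: "f \<in> L2" and e: "e > 0"
  obtains h where "h \<in> test_functions" "L2_norm (\<lambda>y. f y - h y) < e"
proof -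
  obtain g where g: "continuous_on UNIV g" "L2_norm (\<lambda>y. f y - g y) < e / 3"
    using L2_approx_continuous[OF f, of "e / 3"] e by auto
  have cg: "continuous_on {-1..1} g" using g(1) continuous_on_subset by blast
  \<comment> \<open>A uniform error costs the factor \<open>sqrt 2\<close>, the root of the length
    of the interval; \<open>e / 6\<close> leaves room for bounding that factor by 2.\<close>
  then obtain p where p: "polynomial_function p" "\<And>y. y \<in> {-1..1} \<Longrightarrow> cmod (g y - p y) < e / 6"
    using Stone_Weierstrass_polynomial_function[of "{-1..1}" g "e / 6"] e by auto
  have cp: "continuous_on {-1..1} p" using p(1) continuous_on_polymonial_function by blast
  have gL: "g \<in> L2" and pL: "p \<in> L2" using cg cp by (auto intro: L2_continuous)
  have "L2_norm (\<lambda>y. g y - p y) \<le> sqrt 2 * (e / 6)"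
    by (rule L2_bounded(2)) (use L2_measurable[OF gL] L2_measurable[OF pL] p(2) in \<open>auto intro: less_imp_le\<close>)
  also have "\<dots> \<le> 2 * (e / 6)"
    using e sqrt2_less_2 by (intro mult_right_mono) auto
  finally have gp: "L2_norm (\<lambda>y. g y - p y) \<le> e / 3" by simp
  define h where "h n y = p y * cutoff (Suc n) y" for n y
  have h: "h n \<in> test_functions" for n
    unfolding h_def using p(1) by (intro test_functions_mult smooth_polynomial cutoff_test_function) auto
  have "(\<lambda>n. L2_norm (\<lambda>y. p y - h n y)) \<longlonglongrightarrow> 0"
  proof (rule L2_dominated_convergence[where G = "\<lambda>y. 4 * (cmod (p y))\<^sup>2"])
    show "p \<in> borel_measurable \<mu>" "\<And>n. h n \<in> borel_measurable \<mu>"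
      using pL h test_functions_L2 L2_measurable by blast+
    show "AE y in \<mu>. (\<lambda>n. h n y) \<longlonglongrightarrow> p y"
    proof (rule AE_I2)
      fix y assume "y \<in> space \<mu>"
      then have "(\<lambda>n. cutoff (Suc n) y) \<longlonglongrightarrow> 1" by (intro LIMSEQ_Suc cutoff_tendsto) simp
      from tendsto_mult[OF tendsto_const[of "p y"] this] show "(\<lambda>n. h n y) \<longlonglongrightarrow> p y" by (simp add: h_def)
    qed
    show "integrable \<mu> (\<lambda>y. 4 * (cmod (p y))\<^sup>2)"
      using L2_integrable_square[OF pL] by (intro integrable_mult_right)
    show "AE y in \<mu>. (cmod (p y - h n y))\<^sup>2 \<le> 4 * (cmod (p y))\<^sup>2" for n
    proof (rule AE_I2)
      fix y
      have "cmod (1 - cutoff (Suc n) y) \<le> 2"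
        using norm_triangle_ineq4[of 1 "cutoff (Suc n) y"] norm_cutoff_le[of "Suc n" y] by simp
      moreover have "p y - h n y = (1 - cutoff (Suc n) y) * p y" by (simp add: h_def algebra_simps)
      ultimately have "cmod (p y - h n y) \<le> 2 * cmod (p y)"
        by (simp add: norm_mult mult_right_mono)
      from power_mono[OF this norm_ge_zero, of 2] show "(cmod (p y - h n y))\<^sup>2 \<le> 4 * (cmod (p y))\<^sup>2"
        by (simp add: power_mult_distrib)
    qed
  qed
  from order_tendstoD(2)[OF this, of "e / 3"] e obtain n where n: "L2_norm (\<lambda>y. p y - h n y) < e / 3"
    using eventually_happens'[OF sequentially_bot] by fastforce
  have hL: "h n \<in> L2" using h test_functions_L2 by blast
  have "L2_norm (\<lambda>y. f y - h n y) < e"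
    using L2_norm_triangle_diff[OF f gL hL] L2_norm_triangle_diff[OF gL pL hL] g(2) gp n by linarith
  with h show thesis by (rule that)
qed

section \<open>Weak derivatives\<close>

text \<open>Written as an integral over all of \<open>I\<close> against an indicator, so that it
  makes sense for every \<open>L2\<close> function and Cauchy-Schwarz applies directly.\<close>

definition prim :: "(real \<Rightarrow> complex) \<Rightarrow> real \<Rightarrow> complex" where
  "prim g y = (\<integral>x. (if x \<le> y then 1 else 0) * g x \<partial>\<mu>)"

lemma L2_restrict_le:
  assumes "g \<in> L2"
  shows "(\<lambda>x. (if x \<le> y then 1 else 0) * g x) \<in> L2"
    and "L2_norm (\<lambda>x. (if x \<le> y then 1 else 0) * g x) \<le> L2_norm g"
proof -
  have "{x \<in> space \<mu>. x \<le> y} \<in> sets \<mu>"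
    by (auto simp: sets_restrict_space space_restrict_space intro!: image_eqI[of _ _ "{..y}"])
  then have m: "(\<lambda>x. (if x \<le> y then 1 else 0) :: complex) \<in> borel_measurable \<mu>"
    by (intro measurable_If) auto
  show "(\<lambda>x. (if x \<le> y then 1 else 0) * g x) \<in> L2"
    "L2_norm (\<lambda>x. (if x \<le> y then 1 else 0) * g x) \<le> L2_norm g"
    using L2_mult_bounded[OF assms m, of 1] by auto
qed

lemma norm_prim_le: "g \<in> L2 \<Longrightarrow> cmod (prim g y) \<le> sqrt 2 * L2_norm g"
  unfolding prim_def
  using norm_integral_le[OF L2_restrict_le(1)] L2_restrict_le(2)
  by (meson mult_left_mono order_trans real_sqrt_ge_zero zero_le_numeral)

lemma prim_diff:
  assumes "f \<in> L2" "g \<in> L2"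
  shows "prim (\<lambda>x. f x - g x) y = prim f y - prim g y"
  unfolding prim_def right_diff_distrib
  using assms by (intro Bochner_Integration.integral_diff integrable_L2 L2_restrict_le(1))

lemma prim_end: "prim g 1 = (\<integral>x. g x \<partial>\<mu>)"
  unfolding prim_def by (rule Bochner_Integration.integral_cong) auto

lemma prim_start: "prim g (-1) = 0"
proof -
  have "prim g (-1) = (\<integral>x. 0 \<partial>\<mu>)"
    unfolding prim_def by (rule Bochner_Integration.integral_cong) auto
  then show ?thesis by simp
qed

lemma prim_derivative:
  fixes F :: "real \<Rightarrow> complex"
  assumes F: "\<And>y. (F has_vector_derivative f y) (at y)" and f: "continuous_on UNIV f"
    and y: "y \<in> {-1..1}"
  shows "prim f y = F y - F (-1)"
proof -
  have "f \<in> L2" using f continuous_on_subset by (blast intro: L2_continuous)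
  have "(f has_integral (F y - F (-1))) {-1..y}"
    using y F by (intro fundamental_theorem_of_calculus) (auto intro: has_vector_derivative_at_within)
  then have "((\<lambda>x. if x \<in> {-1..y} then f x else 0) has_integral (F y - F (-1))) {-1..1}"
    using y by (subst has_integral_restrict) auto
  moreover have "((\<lambda>x. if x \<in> {-1..y} then f x else 0) has_integral c) {-1..1}
      \<longleftrightarrow> ((\<lambda>x. (if x \<le> y then 1 else 0) * f x) has_integral c) {-1..1}" for c
    by (rule has_integral_cong) auto
  ultimately have "((\<lambda>x. (if x \<le> y then 1 else 0) * f x) has_integral (F y - F (-1))) {-1..1}"
    by blast
  then show ?thesis
    unfolding prim_def integral_interval_eq[OF integrable_L2[OF L2_restrict_le(1)[OF \<open>f \<in> L2\<close>]]]
    by (rule integral_unique)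
qed

text \<open>The primitives of test functions are continuous, and \<open>norm_prim_le\<close> turns
  \<open>L2\<close> convergence into uniform convergence of the primitives.\<close>

lemma continuous_prim:
  assumes g: "g \<in> L2"
  shows "continuous_on {-1..1} (prim g)"
proof -
  have "\<exists>h\<in>test_functions. L2_norm (\<lambda>y. g y - h y) < 1 / real (Suc n)" for n
    using L2_approx_test_function[OF g, of "1 / real (Suc n)"] by auto
  then obtain h where h: "\<And>n. h n \<in> test_functions"
    and hg: "\<And>n. L2_norm (\<lambda>y. g y - h n y) < 1 / real (Suc n)" by metis
  show ?thesis
  proof (rule uniform_limit_theorem)
    show "\<forall>\<^sub>F n in sequentially. continuous_on {-1..1} (prim (h n))"
    proof (rule always_eventually, rule allI)
      fix n
      have c: "continuous_on UNIV (h n)" using smooth_continuous[OF test_functions_smooth[OF h]] .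
      obtain F where F: "\<And>y. (F has_vector_derivative h n y) (at y)"
        using antiderivative_UNIV[OF c] by blast
      have "continuous_on {-1..1} (\<lambda>y. F y - F (-1))"
        using F by (intro continuous_intros)
          (meson continuous_at_imp_continuous_on has_vector_derivative_continuous)
      then show "continuous_on {-1..1} (prim (h n))"
        by (rule continuous_on_eq) (simp add: prim_derivative[OF F c])
    qed
    show "uniform_limit {-1..1} (\<lambda>n. prim (h n)) (prim g) sequentially"
    proof (rule uniform_limitI)
      fix e :: real assume "e > 0"
      have "(\<lambda>n. sqrt 2 * (1 / real (Suc n))) \<longlonglongrightarrow> sqrt 2 * 0"
        using LIMSEQ_inverse_real_of_nat by (intro tendsto_mult tendsto_const) (simp add: inverse_eq_divide)
      then have "\<forall>\<^sub>F n in sequentially. sqrt 2 * (1 / real (Suc n)) < e"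
        using \<open>e > 0\<close> by (intro order_tendstoD(2)) auto
      then show "\<forall>\<^sub>F n in sequentially. \<forall>y\<in>{-1..1}. dist (prim (h n) y) (prim g y) < e"
      proof (rule eventually_mono, intro ballI)
        fix n y assume n: "sqrt 2 * (1 / real (Suc n)) < e"
        have hL: "h n \<in> L2" using test_functions_L2[OF h] .
        have "dist (prim (h n) y) (prim g y) = cmod (prim (\<lambda>y. g y - h n y) y)"
          using prim_diff[OF g hL] by (simp add: dist_norm norm_minus_commute)
        also have "\<dots> \<le> sqrt 2 * L2_norm (\<lambda>y. g y - h n y)"
          using g hL by (intro norm_prim_le) auto
        also have "\<dots> \<le> sqrt 2 * (1 / real (Suc n))"
          using hg[of n] by (intro mult_left_mono) auto
        finally show "dist (prim (h n) y) (prim g y) < e" using n by simp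
      qed
    qed
  qed simp
qed

lemma prim_L2:
  assumes "g \<in> L2"
  shows "prim g \<in> L2" and "L2_norm (prim g) \<le> 2 * L2_norm g"
proof -
  show "prim g \<in> L2" using continuous_prim[OF assms] by (rule L2_continuous)
  then have "L2_norm (prim g) \<le> sqrt 2 * (sqrt 2 * L2_norm g)"
    using norm_prim_le[OF assms] by (intro L2_bounded(2)) auto
  then show "L2_norm (prim g) \<le> 2 * L2_norm g" by (simp flip: mult.assoc)
qed

text \<open>A density argument: the defect \<open>?R\<close> respects differences, is bounded by
  \<open>c\<close> times the \<open>L2\<close> norm of its argument, and vanishes on test functions
  by the fundamental theorem of calculus.\<close>

lemma prim_by_parts:
  assumes g: "g \<in> L2" and \<psi>: "\<psi> \<in> test_functions"
  shows "(\<integral>y. prim g y * D \<psi> y \<partial>\<mu>) = - (\<integral>y. g y * \<psi> y \<partial>\<mu>)"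
proof -
  let ?R = "\<lambda>g. (\<integral>y. prim g y * D \<psi> y \<partial>\<mu>) + (\<integral>y. g y * \<psi> y \<partial>\<mu>)"
  define c where "c = 2 * L2_norm (D \<psi>) + L2_norm \<psi>"
  have \<psi>L: "\<psi> \<in> L2" "D \<psi> \<in> L2" using \<psi> by (auto intro: test_functions_L2 test_functions_deriv)
  have bound: "cmod (?R f) \<le> c * L2_norm f" if "f \<in> L2" for f
  proof -
    have "cmod (?R f) \<le> L2_norm (prim f) * L2_norm (D \<psi>) + L2_norm f * L2_norm \<psi>"
      using L2_Cauchy_Schwarz[OF prim_L2(1)[OF that] \<psi>L(2)] L2_Cauchy_Schwarz[OF that \<psi>L(1)]
      by (intro order_trans[OF norm_triangle_ineq] add_mono)
    also have "\<dots> \<le> 2 * L2_norm f * L2_norm (D \<psi>) + L2_norm f * L2_norm \<psi>"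
      using prim_L2(2)[OF that] by (intro add_mono mult_right_mono) auto
    finally show ?thesis by (simp add: c_def algebra_simps)
  qed
  have zero: "?R h = 0" if h: "h \<in> test_functions" for h
  proof -
    have ch: "continuous_on UNIV h" using smooth_continuous[OF test_functions_smooth[OF h]] .
    obtain F where F: "\<And>y. (F has_vector_derivative h y) (at y)"
      using antiderivative_UNIV[OF ch] by blast
    define H where "H y = F y - F (-1)" for y
    have H: "(H has_vector_derivative h y) (at y)" for y
      using has_vector_derivative_diff[OF F has_vector_derivative_const[of "F (-1)"]] by (simp add: H_def[abs_def])
    have d: "((\<lambda>y. H y * \<psi> y) has_vector_derivative H y * D \<psi> y + h y * \<psi> y) (at y)" for y
      using has_vector_derivative_mult[OF H smooth_has_deriv[OF test_functions_smooth[OF \<psi>]]] .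
    have cH: "continuous_on {-1..1} H"
      using H by (meson continuous_at_imp_continuous_on has_vector_derivative_continuous)
    have c: "continuous_on {-1..1} h" "continuous_on {-1..1} \<psi>" "continuous_on {-1..1} (D \<psi>)"
      using h \<psi> by (auto intro!: smooth_continuous test_functions_smooth smooth_deriv)
    have "?R h = (\<integral>y. H y * D \<psi> y \<partial>\<mu>) + (\<integral>y. h y * \<psi> y \<partial>\<mu>)"
      by (intro arg_cong2[where f = plus] Bochner_Integration.integral_cong)
        (auto simp: prim_derivative[OF F ch] H_def)
    also have "\<dots> = (\<integral>y. H y * D \<psi> y + h y * \<psi> y \<partial>\<mu>)"
      using L2_continuous[OF cH] test_functions_L2[OF h] \<psi>L
      by (intro Bochner_Integration.integral_add[symmetric] integrable_L2_mult)
    also have "\<dots> = H 1 * \<psi> 1 - H (-1) * \<psi> (-1)"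
      by (rule FTC_interval[OF d]) (intro continuous_intros cH c)
    finally show ?thesis using test_functions_boundary[OF \<psi>] by simp
  qed
  have "cmod (?R g) \<le> e" if "e > 0" for e
  proof -
    have c: "c \<ge> 0" by (simp add: c_def)
    then obtain h where h: "h \<in> test_functions" "L2_norm (\<lambda>y. g y - h y) < e / (c + 1)"
      using L2_approx_test_function[OF g, of "e / (c + 1)"] \<open>e > 0\<close> by auto
    have hL: "h \<in> L2" using h test_functions_L2 by blast
    have "?R (\<lambda>y. g y - h y) = ?R g - ?R h"
      using g hL \<psi>L
      by (simp add: prim_diff left_diff_distrib Bochner_Integration.integral_diff
          integrable_L2_mult prim_L2(1))
    then have "cmod (?R g) = cmod (?R (\<lambda>y. g y - h y))" using zero[OF h(1)] by simp
    also have "\<dots> \<le> c * L2_norm (\<lambda>y. g y - h y)" using g hL by (intro bound) auto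
    also have "\<dots> \<le> c * (e / (c + 1))" using h(2) c by (intro mult_left_mono) auto
    also have "\<dots> \<le> e" using c \<open>e > 0\<close> by (simp add: field_simps)
    finally show ?thesis .
  qed
  then have "cmod (?R g) \<le> 0" by (rule field_le_epsilon) simp
  then show ?thesis by (simp add: add_eq_0_iff2)
qed

text \<open>Approximating the conjugate of \<open>g\<close> by a test function \<open>h\<close>
  exhibits \<open>(L2_norm g)\<^sup>2\<close> as the integral of \<open>g * (cnj g - h)\<close>,
  which Cauchy-Schwarz makes arbitrarily small.\<close>

lemma L2_eq_0_if_orthogonal:
  assumes g: "g \<in> L2" and orth: "\<And>\<psi>. \<psi> \<in> test_functions \<Longrightarrow> (\<integral>y. g y * \<psi> y \<partial>\<mu>) = 0"
  shows "AE y in \<mu>. g y = 0"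
proof -
  have "(L2_norm g)\<^sup>2 \<le> 0 + e" if "e > 0" for e
  proof -
    have cL: "(\<lambda>y. cnj (g y)) \<in> L2" using g by auto
    obtain h where h: "h \<in> test_functions" "L2_norm (\<lambda>y. cnj (g y) - h y) < e / (L2_norm g + 1)"
      using L2_approx_test_function[OF cL, of "e / (L2_norm g + 1)"] \<open>e > 0\<close>
        add_nonneg_pos[OF L2_norm_nonneg zero_less_one] by (metis divide_pos_pos)
    have hL: "h \<in> L2" using h test_functions_L2 by blast
    have "complex_of_real ((L2_norm g)\<^sup>2) = (\<integral>y. g y * cnj (g y) \<partial>\<mu>)"
      unfolding L2_norm_square integral_complex_of_real[symmetric] complex_norm_square ..
    also have "\<dots> = (\<integral>y. g y * (cnj (g y) - h y) \<partial>\<mu>)"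
      using orth[OF h(1)] integrable_L2_mult[OF g cL] integrable_L2_mult[OF g hL]
      by (simp add: right_diff_distrib)
    finally have "(L2_norm g)\<^sup>2 = cmod (\<integral>y. g y * (cnj (g y) - h y) \<partial>\<mu>)"
      by (metis norm_of_real abs_power2)
    also have "\<dots> \<le> L2_norm g * L2_norm (\<lambda>y. cnj (g y) - h y)"
      using g cL hL by (intro L2_Cauchy_Schwarz) auto
    also have "\<dots> \<le> L2_norm g * (e / (L2_norm g + 1))"
      using h(2) by (intro mult_left_mono) auto
    also have "\<dots> \<le> e"
      using \<open>e > 0\<close> add_nonneg_pos[OF L2_norm_nonneg zero_less_one, of g] by (simp add: field_simps)
    finally show ?thesis by simp
  qed
  then have "(L2_norm g)\<^sup>2 \<le> 0" by (rule field_le_epsilon)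
  then show ?thesis using L2_norm_eq_0_iff[OF g] by simp
qed

text \<open>A test function within \<open>L2\<close> distance 1 of the constant 1 cannot have
  integral 0, since its integral differs from 2 by at most \<open>sqrt 2\<close>. Dividing by the
  integral normalises it.\<close>

lemma normalized_test_function:
  obtains \<theta> where "\<theta> \<in> test_functions" "(\<integral>y. \<theta> y \<partial>\<mu>) = 1"
proof -
  obtain h where h: "h \<in> test_functions" "L2_norm (\<lambda>y. 1 - h y) < 1"
    using L2_approx_test_function[OF L2_const[of 1], of 1] by auto
  have hL: "h \<in> L2" using h test_functions_L2 by blast
  define c where "c = (\<integral>y. h y \<partial>\<mu>)"
  have "c \<noteq> 0"
  proof
    assume "c = 0"
    then have "(\<integral>y. 1 - h y \<partial>\<mu>) = 2"
      using integrable_L2[OF hL] integrable_L2[OF L2_const[of 1]]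
      by (simp add: c_def measure_interval scaleR_conv_of_real)
    then have "2 \<le> sqrt 2 * L2_norm (\<lambda>y. 1 - h y)"
      using norm_integral_le[OF L2_diff[OF L2_const[of 1] hL]] by simp
    also have "\<dots> \<le> sqrt 2 * 1" using h(2) by (intro mult_left_mono) auto
    finally show False using sqrt2_less_2 by simp
  qed
  show thesis
  proof (rule that)
    show "(\<lambda>y. (1 / c) * h y) \<in> test_functions" using h by (intro test_functions_scale)
    show "(\<integral>y. (1 / c) * h y \<partial>\<mu>) = 1"
      using \<open>c \<noteq> 0\<close> integrable_L2[OF hL] by (simp add: c_def)
  qed
qed

text \<open>Subtracting \<open>a * \<theta>\<close> gives any test function integral 0 and hence
  makes it the derivative of another one. Testing with it shows that \<open>f - c\<close> is
  orthogonal to every test function, where \<open>c\<close> is the pairing of \<open>f\<close> with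
  \<open>\<theta>\<close>.\<close>

lemma du_Bois_Reymond:
  assumes f: "f \<in> L2" and orth: "\<And>\<psi>. \<psi> \<in> test_functions \<Longrightarrow> (\<integral>y. f y * D \<psi> y \<partial>\<mu>) = 0"
  obtains c where "AE y in \<mu>. f y = c"
proof -
  obtain \<theta> where \<theta>: "\<theta> \<in> test_functions" "(\<integral>y. \<theta> y \<partial>\<mu>) = 1"
    by (rule normalized_test_function)
  have \<theta>L: "\<theta> \<in> L2" using \<theta> test_functions_L2 by blast
  define c where "c = (\<integral>y. f y * \<theta> y \<partial>\<mu>)"
  have "AE y in \<mu>. f y - c = 0"
  proof (rule L2_eq_0_if_orthogonal)
    show "(\<lambda>y. f y - c) \<in> L2" using f by auto
    fix h assume h: "h \<in> test_functions"
    have hL: "h \<in> L2" using h test_functions_L2 by blast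
    define a where "a = (\<integral>y. h y \<partial>\<mu>)"
    have "(\<lambda>y. h y - a * \<theta> y) \<in> test_functions" "(\<integral>y. h y - a * \<theta> y \<partial>\<mu>) = 0"
      using h \<theta> integrable_L2[OF hL] integrable_L2[OF \<theta>L]
      by (auto intro: test_functions_diff test_functions_scale simp: a_def)
    then obtain H where "H \<in> test_functions" "D H = (\<lambda>y. h y - a * \<theta> y)"
      by (rule test_functions_antideriv)
    then have "0 = (\<integral>y. f y * (h y - a * \<theta> y) \<partial>\<mu>)" using orth by metis
    also have "\<dots> = (\<integral>y. f y * h y - a * (f y * \<theta> y) \<partial>\<mu>)"
      by (simp add: algebra_simps)
    also have "\<dots> = (\<integral>y. f y * h y \<partial>\<mu>) - a * c"
      using integrable_L2_mult[OF f hL] integrable_L2_mult[OF f \<theta>L] by (simp add: c_def)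
    also have "\<dots> = (\<integral>y. f y * h y - c * h y \<partial>\<mu>)"
      using integrable_L2_mult[OF f hL] integrable_L2[OF hL] by (simp add: a_def)
    finally show "(\<integral>y. (f y - c) * h y \<partial>\<mu>) = 0" by (simp add: left_diff_distrib)
  qed
  then show thesis by (intro that[of c]) simp
qed

lemma has_weak_deriv_integral:
  "has_weak_deriv f g \<Longrightarrow> \<psi> \<in> test_functions \<Longrightarrow>
    (\<integral>y. f y * D \<psi> y \<partial>\<mu>) = - (\<integral>y. g y * \<psi> y \<partial>\<mu>)"
  by (metis distr_deriv_def distr_of_def has_weak_deriv_def minus_minus)

lemma weak_deriv_unique:
  assumes "has_weak_deriv f g" "has_weak_deriv f h"
  shows "AE y in \<mu>. g y = h y"
proof -
  have L: "g \<in> L2" "h \<in> L2" using assms by (auto simp: has_weak_deriv_def)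
  have "AE y in \<mu>. g y - h y = 0"
  proof (rule L2_eq_0_if_orthogonal)
    show "(\<lambda>y. g y - h y) \<in> L2" using L by auto
    fix \<psi> assume \<psi>: "\<psi> \<in> test_functions"
    have "\<psi> \<in> L2" using \<psi> test_functions_L2 by blast
    then show "(\<integral>y. (g y - h y) * \<psi> y \<partial>\<mu>) = 0"
      using has_weak_deriv_integral[OF assms(1) \<psi>] has_weak_deriv_integral[OF assms(2) \<psi>] L
      by (simp add: left_diff_distrib integrable_L2_mult)
  qed
  then show ?thesis by simp
qed

lemma H1_has_weak_deriv: "f \<in> H1 \<Longrightarrow> has_weak_deriv f (weak_deriv f)"
  unfolding H1_def weak_deriv_def by (simp add: someI_ex)

text \<open>The difference of \<open>f\<close> and \<open>prim g\<close> has weak derivative zero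
  and is therefore constant. The left boundary value makes the constant 0, and the right one then
  becomes a condition on the integral of \<open>g\<close>: this is how boundary conditions turn into
  moment conditions.\<close>

lemma zero_boundary_values_prim:
  assumes fg: "has_weak_deriv f g"
    and left: "has_boundary_value f (-1) 0" and right: "has_boundary_value f 1 0"
  shows "AE y in \<mu>. f y = prim g y" and "prim g 1 = 0"
proof -
  have L: "f \<in> L2" "g \<in> L2" using fg by (auto simp: has_weak_deriv_def)
  have "(\<lambda>y. f y - prim g y) \<in> L2" using L prim_L2 by auto
  then obtain c where c: "AE y in \<mu>. f y - prim g y = c"
  proof (rule du_Bois_Reymond)
    fix \<psi> assume \<psi>: "\<psi> \<in> test_functions"
    have "D \<psi> \<in> L2" using \<psi> test_functions_L2 test_functions_deriv by blast
    then show "(\<integral>y. (f y - prim g y) * D \<psi> y \<partial>\<mu>) = 0"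
      using has_weak_deriv_integral[OF fg \<psi>] prim_by_parts[OF L(2) \<psi>] L prim_L2(1)
      by (simp add: left_diff_distrib integrable_L2_mult)
  qed
  \<comment> \<open>The continuous representative of \<open>f\<close> and the primitive are both
    continuous up to the endpoints, so the almost everywhere identity may be evaluated
    there.\<close>
  have end_eq: "- prim g b = c" if b: "has_boundary_value f b 0" "b \<in> {-1..1}" for b
  proof -
    obtain u where u: "continuous_on {-1..1} u" "AE y in \<mu>. u y = f y" "u b = 0"
      using b(1) by (auto simp: has_boundary_value_def)
    have "AE y in \<mu>. u y - prim g y = c"
      using u(2) c by eventually_elim simp
    then have "u b - prim g b = c"
      using u(1) continuous_prim[OF L(2)] b(2)
      by (intro continuous_AE_const[where f = "\<lambda>y. u y - prim g y"] continuous_intros)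
    then show ?thesis using u(3) by simp
  qed
  have "c = 0" using end_eq[OF left] prim_start by simp
  with c show "AE y in \<mu>. f y = prim g y" by simp
  show "prim g 1 = 0" using end_eq[OF right] \<open>c = 0\<close> by simp
qed

section \<open>Approximation of clamped functions and the elliptic estimate\<close>

text \<open>Here \<open>a\<close> is the integral of \<open>v\<close>; since \<open>u\<close> has
  integral 0, \<open>a\<close> is of the order of the error \<open>u - v\<close>. Subtracting
  \<open>a * \<theta>\<close> thus keeps the error of the same order and makes \<open>v\<close>
  integrable to a test function \<open>V\<close>. The leading 2 in the last bound is the norm bound
  for \<open>prim\<close>.\<close>

lemma mean_zero_correction:
  assumes u: "u \<in> L2" "(\<integral>y. u y \<partial>\<mu>) = 0" and v: "v \<in> test_functions"
    and \<theta>: "\<theta> \<in> test_functions" "(\<integral>y. \<theta> y \<partial>\<mu>) = 1"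
  obtains a V where "V \<in> test_functions" "\<And>y. D V y = v y - a * \<theta> y"
    "cmod a \<le> sqrt 2 * L2_norm (\<lambda>y. u y - v y)"
    "L2_norm (\<lambda>y. prim u y - V y) \<le> 2 * (1 + sqrt 2 * L2_norm \<theta>) * L2_norm (\<lambda>y. u y - v y)"
proof -
  define a where "a = (\<integral>y. v y \<partial>\<mu>)"
  define v1 where "v1 y = v y - a * \<theta> y" for y
  have L: "v \<in> L2" "\<theta> \<in> L2" using v \<theta> test_functions_L2 by blast+
  have v1: "v1 \<in> test_functions"
    unfolding v1_def using v \<theta> by (intro test_functions_diff test_functions_scale)
  have "(\<integral>y. v1 y \<partial>\<mu>) = 0"
    unfolding v1_def using L \<theta>(2) by (simp add: integrable_L2 a_def)
  with v1 obtain V where V: "V \<in> test_functions" "D V = v1" by (rule test_functions_antideriv)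
  have "a = - (\<integral>y. u y - v y \<partial>\<mu>)"
    using u L by (simp add: a_def integrable_L2)
  then have a: "cmod a \<le> sqrt 2 * L2_norm (\<lambda>y. u y - v y)"
    using norm_integral_le[OF L2_diff[OF u(1) L(1)]] by simp
  have v1L: "v1 \<in> L2" using v1 test_functions_L2 by blast
  have "L2_norm (\<lambda>y. u y - v1 y) = L2_norm (\<lambda>y. (u y - v y) + a * \<theta> y)"
    by (simp add: v1_def algebra_simps)
  also have "\<dots> \<le> L2_norm (\<lambda>y. u y - v y) + cmod a * L2_norm \<theta>"
    using L2_norm_triangle[OF L2_diff[OF u(1) L(1)] L2_scale[OF L(2)]] by (simp add: L2_norm_scale)
  also have "\<dots> \<le> L2_norm (\<lambda>y. u y - v y) + sqrt 2 * L2_norm (\<lambda>y. u y - v y) * L2_norm \<theta>"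
    using a by (intro add_left_mono mult_right_mono) auto
  finally have uv1: "L2_norm (\<lambda>y. u y - v1 y) \<le> (1 + sqrt 2 * L2_norm \<theta>) * L2_norm (\<lambda>y. u y - v y)"
    by (simp add: algebra_simps)
  have DV: "D V y = v1 y" for y
    using V(2) by meson
  have dV: "(V has_vector_derivative v1 y) (at y)" for y
    using smooth_has_deriv[OF test_functions_smooth[OF V(1)], of y] unfolding DV .
  have "prim v1 y = V y" if "y \<in> I" for y
    using prim_derivative[OF dV smooth_continuous[OF test_functions_smooth[OF v1]], of y]
      test_functions_boundary[OF V(1)] that by simp
  then have "L2_norm (\<lambda>y. prim u y - V y) = L2_norm (prim (\<lambda>y. u y - v1 y))"
    using prim_diff[OF u(1) v1L]
    unfolding L2_norm_def by (intro arg_cong[where f = sqrt] Bochner_Integration.integral_cong) auto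
  also have "\<dots> \<le> 2 * L2_norm (\<lambda>y. u y - v1 y)"
    using u(1) v1L by (intro prim_L2(2)) auto
  also have "\<dots> \<le> 2 * (1 + sqrt 2 * L2_norm \<theta>) * L2_norm (\<lambda>y. u y - v y)"
    unfolding mult.assoc[of 2] by (rule mult_left_mono[OF uv1]) simp
  finally have pV: "L2_norm (\<lambda>y. prim u y - V y)
      \<le> 2 * (1 + sqrt 2 * L2_norm \<theta>) * L2_norm (\<lambda>y. u y - v y)" .
  show thesis by (rule that[OF V(1) _ a pV]) (simp add: DV v1_def)
qed

text \<open>The mean correction is applied twice, first to \<open>h\<close> and then to
  \<open>g\<close>, whose integrals vanish by the boundary values of \<open>g\<close> and of
  \<open>f\<close>. The second correction is made one derivative lower, so it reappears in the
  second derivative as \<open>b * D \<theta>\<close>; its coefficient is still of the order of the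
  error.\<close>

lemma clamped_approximation:
  assumes fg: "has_weak_deriv f g" and gh: "has_weak_deriv g h"
    and bf: "has_boundary_value f (-1) 0" "has_boundary_value f 1 0"
    and bg: "has_boundary_value g (-1) 0" "has_boundary_value g 1 0"
  obtains \<psi> where "\<And>n. \<psi> n \<in> test_functions"
    "(\<lambda>n. L2_norm (\<lambda>y. f y - \<psi> n y)) \<longlonglongrightarrow> 0"
    "(\<lambda>n. L2_norm (\<lambda>y. g y - D (\<psi> n) y)) \<longlonglongrightarrow> 0"
    "(\<lambda>n. L2_norm (\<lambda>y. h y - D (D (\<psi> n)) y)) \<longlonglongrightarrow> 0"
proof -
  have L: "f \<in> L2" "g \<in> L2" "h \<in> L2" using fg gh by (auto simp: has_weak_deriv_def)
  note f_prim = zero_boundary_values_prim[OF fg bf] and g_prim = zero_boundary_values_prim[OF gh bg]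
  obtain \<theta> where \<theta>: "\<theta> \<in> test_functions" "(\<integral>y. \<theta> y \<partial>\<mu>) = 1"
    by (rule normalized_test_function)
  have \<theta>L: "\<theta> \<in> L2" "D \<theta> \<in> L2"
    using \<theta> by (auto intro: test_functions_L2 test_functions_deriv)
  define K where "K = 2 * (1 + sqrt 2 * L2_norm \<theta>)"
  have K: "K \<ge> 2" by (simp add: K_def)
  \<comment> \<open>\<open>K * K\<close> covers the errors of the function and of its first
    derivative; the last two summands cover that of the second derivative.\<close>
  define C where "C = K * K + K * K + K + sqrt 2 * K * L2_norm (D \<theta>)"
  have C: "K * K \<le> C" "K + sqrt 2 * K * L2_norm (D \<theta>) \<le> C"
    using K by (auto simp: C_def)
  have approx: "\<exists>\<psi>\<in>test_functions. L2_norm (\<lambda>y. f y - \<psi> y) \<le> C * e \<and>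
      L2_norm (\<lambda>y. g y - D \<psi> y) \<le> C * e \<and> L2_norm (\<lambda>y. h y - D (D \<psi>) y) \<le> C * e" if "e > 0" for e
  proof -
    obtain v where v: "v \<in> test_functions" "L2_norm (\<lambda>y. h y - v y) < e"
      using L2_approx_test_function[OF L(3) \<open>e > 0\<close>] by metis
    have vL: "v \<in> L2" using v test_functions_L2 by blast
    have h0: "(\<integral>y. h y \<partial>\<mu>) = 0" using g_prim(2) by (simp add: prim_end)
    obtain a V where V: "V \<in> test_functions" "\<And>y. D V y = v y - a * \<theta> y"
      and a: "cmod a \<le> sqrt 2 * L2_norm (\<lambda>y. h y - v y)"
      and pV: "L2_norm (\<lambda>y. prim h y - V y) \<le> K * L2_norm (\<lambda>y. h y - v y)"
      by (rule mean_zero_correction[OF L(3) h0 v(1) \<theta>, folded K_def]) (rule that)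
    have VL: "V \<in> L2" using V test_functions_L2 by blast
    have "L2_norm (\<lambda>y. g y - V y) = L2_norm (\<lambda>y. prim h y - V y)"
      using L VL prim_L2(1)[OF L(3)] g_prim(1)
      by (intro L2_norm_cong_AE) (auto elim: eventually_mono)
    also have "\<dots> \<le> K * e"
      using order_trans[OF pV mult_left_mono[OF less_imp_le[OF v(2)]]] K by simp
    finally have gV: "L2_norm (\<lambda>y. g y - V y) \<le> K * e" .
    have g0: "(\<integral>y. g y \<partial>\<mu>) = 0" using f_prim(2) by (simp add: prim_end)
    obtain b W where W: "W \<in> test_functions" "\<And>y. D W y = V y - b * \<theta> y"
      and b: "cmod b \<le> sqrt 2 * L2_norm (\<lambda>y. g y - V y)"
      and pW: "L2_norm (\<lambda>y. prim g y - W y) \<le> K * L2_norm (\<lambda>y. g y - V y)"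
      by (rule mean_zero_correction[OF L(2) g0 V(1) \<theta>, folded K_def]) (rule that)
    have WL: "W \<in> L2" using W test_functions_L2 by blast
    have b': "cmod b \<le> sqrt 2 * K * e"
      using order_trans[OF b mult_left_mono[OF gV]] by simp
    have "L2_norm (\<lambda>y. f y - W y) = L2_norm (\<lambda>y. prim g y - W y)"
      using L WL prim_L2(1)[OF L(2)] f_prim(1)
      by (intro L2_norm_cong_AE) (auto elim: eventually_mono)
    also have "\<dots> \<le> K * (K * e)"
      using order_trans[OF pW mult_left_mono[OF gV]] K by simp
    also have "\<dots> \<le> C * e" using C(1) \<open>e > 0\<close> by (simp flip: mult.assoc)
    finally have 1: "L2_norm (\<lambda>y. f y - W y) \<le> C * e" .
    have "L2_norm (\<lambda>y. g y - D W y) = L2_norm (\<lambda>y. (g y - V y) + b * \<theta> y)"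
      by (simp add: W(2) algebra_simps)
    also have "\<dots> \<le> L2_norm (\<lambda>y. g y - V y) + cmod b * L2_norm \<theta>"
      using L2_norm_triangle[OF L2_diff[OF L(2) VL] L2_scale[OF \<theta>L(1)]] by (simp add: L2_norm_scale)
    also have "\<dots> \<le> K * e + sqrt 2 * K * e * L2_norm \<theta>"
      using gV b' by (intro add_mono mult_right_mono) auto
    also have "\<dots> = (1 + sqrt 2 * L2_norm \<theta>) * (K * e)"
      by (simp add: algebra_simps)
    \<comment> \<open>The factor \<open>1 + sqrt 2 * L2_norm \<theta>\<close> is half of
      \<open>K\<close>.\<close>
    also have "\<dots> \<le> K * (K * e)"
      using K \<open>e > 0\<close> by (intro mult_right_mono) (auto simp: K_def)
    also have "\<dots> \<le> C * e" using C(1) \<open>e > 0\<close> by (simp flip: mult.assoc)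
    finally have 2: "L2_norm (\<lambda>y. g y - D W y) \<le> C * e" .
    have DDW: "D (D W) y = v y - a * \<theta> y - b * D \<theta> y" for y
    proof -
      have "(V has_vector_derivative v y - a * \<theta> y) (at y)"
        using smooth_has_deriv[OF test_functions_smooth[OF V(1)], of y] by (simp add: V(2))
      moreover have "((\<lambda>y. b * \<theta> y) has_vector_derivative b * D \<theta> y) (at y)"
        using has_vector_derivative_mult_right[OF smooth_has_deriv[OF test_functions_smooth[OF \<theta>(1)]]] .
      ultimately have "((\<lambda>y. V y - b * \<theta> y) has_vector_derivative v y - a * \<theta> y - b * D \<theta> y) (at y)"
        by (rule has_vector_derivative_diff)
      then show "D (D W) y = v y - a * \<theta> y - b * D \<theta> y"
        unfolding W(2) by (rule vector_derivative_at)
    qed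
    have "L2_norm (\<lambda>y. h y - D (D W) y) = L2_norm (\<lambda>y. ((h y - v y) + a * \<theta> y) + b * D \<theta> y)"
      by (simp add: DDW algebra_simps)
    also have "\<dots> \<le> L2_norm (\<lambda>y. h y - v y) + cmod a * L2_norm \<theta> + cmod b * L2_norm (D \<theta>)"
      using L2_norm_triangle[OF L2_add[OF L2_diff[OF L(3) vL] L2_scale[OF \<theta>L(1)]] L2_scale[OF \<theta>L(2)], of a b]
        L2_norm_triangle[OF L2_diff[OF L(3) vL] L2_scale[OF \<theta>L(1)], of a] by (simp add: L2_norm_scale)
    also have "\<dots> \<le> e + sqrt 2 * e * L2_norm \<theta> + sqrt 2 * K * e * L2_norm (D \<theta>)"
      using v(2) a b' by (intro add_mono mult_right_mono) (auto intro: order_trans)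
    also have "\<dots> = (1 + sqrt 2 * L2_norm \<theta> + sqrt 2 * K * L2_norm (D \<theta>)) * e"
      by (simp add: algebra_simps)
    also have "\<dots> \<le> C * e"
      using C(2) K \<open>e > 0\<close> by (intro mult_right_mono) (auto simp: K_def intro: order_trans[rotated])
    finally have 3: "L2_norm (\<lambda>y. h y - D (D W) y) \<le> C * e" .
    show ?thesis using W(1) 1 2 3 by blast
  qed
  define P where "P e \<psi> \<longleftrightarrow> \<psi> \<in> test_functions \<and> L2_norm (\<lambda>y. f y - \<psi> y) \<le> C * e \<and>
      L2_norm (\<lambda>y. g y - D \<psi> y) \<le> C * e \<and> L2_norm (\<lambda>y. h y - D (D \<psi>) y) \<le> C * e" for e \<psi>
  have "\<exists>\<psi>. P e \<psi>" if "e > 0" for e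
    using approx[OF that] unfolding P_def Bex_def .
  then have "\<forall>n. \<exists>\<psi>. P (1 / real (Suc n)) \<psi>" by simp
  from choice[OF this] obtain \<psi> where "\<forall>n. P (1 / real (Suc n)) (\<psi> n)" by blast
  then have \<psi>: "\<psi> n \<in> test_functions"
    "L2_norm (\<lambda>y. f y - \<psi> n y) \<le> C * (1 / real (Suc n))"
    "L2_norm (\<lambda>y. g y - D (\<psi> n) y) \<le> C * (1 / real (Suc n))"
    "L2_norm (\<lambda>y. h y - D (D (\<psi> n)) y) \<le> C * (1 / real (Suc n))" for n
    unfolding P_def by blast+
  have lim: "(\<lambda>n. C * (1 / real (Suc n))) \<longlonglongrightarrow> 0"
    using tendsto_mult_right_zero[OF LIMSEQ_inverse_real_of_nat] by (simp add: inverse_eq_divide)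
  show thesis
  proof (rule that)
    show "\<psi> n \<in> test_functions" for n by (rule \<psi>(1))
    show "(\<lambda>n. L2_norm (\<lambda>y. f y - \<psi> n y)) \<longlonglongrightarrow> 0"
      by (rule tendsto_sandwich[OF _ _ tendsto_const lim]) (simp_all only: L2_norm_nonneg \<psi> eventually_True)
    show "(\<lambda>n. L2_norm (\<lambda>y. g y - D (\<psi> n) y)) \<longlonglongrightarrow> 0"
      by (rule tendsto_sandwich[OF _ _ tendsto_const lim]) (simp_all only: L2_norm_nonneg \<psi> eventually_True)
    show "(\<lambda>n. L2_norm (\<lambda>y. h y - D (D (\<psi> n)) y)) \<longlonglongrightarrow> 0"
      by (rule tendsto_sandwich[OF _ _ tendsto_const lim]) (simp_all only: L2_norm_nonneg \<psi> eventually_True)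
  qed
qed

section \<open>Energy identities for the Helmholtz operator on test functions\<close>

lemma test_functions_by_parts:
  assumes u: "smooth u" and v: "v \<in> test_functions"
  shows "(\<integral>y. D u y * v y \<partial>\<mu>) = - (\<integral>y. u y * D v y \<partial>\<mu>)"
proof -
  have sv: "smooth v" using v test_functions_smooth by blast
  have L: "u \<in> L2" "D u \<in> L2" "v \<in> L2" "D v \<in> L2"
    using u sv by (auto intro!: L2_continuous smooth_continuous smooth_deriv)
  have "(\<integral>y. u y * D v y + D u y * v y \<partial>\<mu>) = u 1 * v 1 - u (-1) * v (-1)"
    using u sv
    by (intro FTC_interval has_vector_derivative_mult smooth_has_deriv continuous_intros
        smooth_continuous smooth_deriv) auto
  then show ?thesis
    using L test_functions_boundary[OF v] by (simp add: integrable_L2_mult add_eq_0_iff)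
qed

lemma D_cnj: "smooth \<psi> \<Longrightarrow> D (\<lambda>y. cnj (\<psi> y)) y = cnj (D \<psi> y)"
  by (intro vector_derivative_at has_vector_derivative_cnj smooth_has_deriv)

lemma integral_mult_cnj: "(\<integral>y. f y * cnj (f y) \<partial>\<mu>) = of_real ((L2_norm f)\<^sup>2)"
  unfolding L2_norm_square integral_complex_of_real[symmetric] complex_norm_square ..

definition helmholtz :: "real \<Rightarrow> (real \<Rightarrow> complex) \<Rightarrow> real \<Rightarrow> complex" where
  "helmholtz \<kappa> \<psi> y = D (D \<psi>) y - of_real (\<kappa>\<^sup>2) * \<psi> y"

lemma helmholtz_test_function: "\<psi> \<in> test_functions \<Longrightarrow> helmholtz \<kappa> \<psi> \<in> test_functions"
  unfolding helmholtz_def by (intro test_functions_diff test_functions_scale test_functions_deriv)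

lemma helmholtz_cnj: "\<psi> \<in> test_functions \<Longrightarrow> helmholtz \<kappa> (\<lambda>y. cnj (\<psi> y)) y = cnj (helmholtz \<kappa> \<psi> y)"
  by (simp add: helmholtz_def D_cnj test_functions_smooth smooth_deriv)

text \<open>One integration by parts. The right side is minus the squared \<open>L2\<close> norm of
  the velocity belonging to the stream function \<open>\<psi>\<close>.\<close>

lemma helmholtz_pairing:
  assumes \<psi>: "\<psi> \<in> test_functions"
  shows "(\<integral>y. helmholtz \<kappa> \<psi> y * cnj (\<psi> y) \<partial>\<mu>)
    = - of_real ((L2_norm (D \<psi>))\<^sup>2 + \<kappa>\<^sup>2 * (L2_norm \<psi>)\<^sup>2)"
proof -
  have s: "smooth \<psi>" using \<psi> test_functions_smooth by blast
  have L: "\<psi> \<in> L2" "D \<psi> \<in> L2" "D (D \<psi>) \<in> L2" "(\<lambda>y. cnj (\<psi> y)) \<in> L2"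
    using \<psi> by (auto intro!: test_functions_L2 test_functions_deriv test_functions_cnj)
  have "(\<integral>y. D (D \<psi>) y * cnj (\<psi> y) \<partial>\<mu>) = - (\<integral>y. D \<psi> y * cnj (D \<psi> y) \<partial>\<mu>)"
    using test_functions_by_parts[OF smooth_deriv[OF s] test_functions_cnj[OF \<psi>]] by (simp add: D_cnj s)
  then show ?thesis
    using L integrable_L2_mult[OF L(3) L(4)] integrable_L2_mult[OF L(1) L(4)]
    unfolding helmholtz_def left_diff_distrib mult.assoc by (simp add: integral_mult_cnj)
qed

text \<open>After one integration by parts every term is the integral of a real weight times a
  squared modulus, except the one in which the derivative falls on the weight \<open>y - l\<close>.
  Only that commutator can have an imaginary part, and \<open>l\<close> no longer occurs in
  it.\<close>

lemma helmholtz_pairing_shear: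
  assumes \<psi>: "\<psi> \<in> test_functions"
  shows "Im (\<integral>y. of_real (y - l) * helmholtz \<kappa> \<psi> y * cnj (\<psi> y) \<partial>\<mu>)
    = - Im (\<integral>y. D \<psi> y * cnj (\<psi> y) \<partial>\<mu>)"
proof -
  have s: "smooth \<psi>" using \<psi> test_functions_smooth by blast
  have sl: "smooth (\<lambda>y. complex_of_real (y - l))"
    using smooth_diff[OF smooth_of_real smooth_const] by simp
  have \<psi>': "(\<lambda>y. cnj (\<psi> y)) \<in> test_functions" using \<psi> by (rule test_functions_cnj)
  have q: "(\<lambda>y. of_real (y - l) * cnj (\<psi> y)) \<in> test_functions"
    using sl \<psi>' by (rule test_functions_mult)
  have D\<psi>': "(\<lambda>y. cnj (D \<psi> y)) \<in> test_functions"
    using \<psi> by (intro test_functions_cnj test_functions_deriv)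
  have r: "(\<lambda>y. of_real (y - l) * cnj (D \<psi> y)) \<in> test_functions"
    using sl D\<psi>' by (rule test_functions_mult)
  note L = test_functions_L2[OF \<psi>] test_functions_L2[OF test_functions_deriv[OF \<psi>]]
    test_functions_L2[OF test_functions_deriv[OF test_functions_deriv[OF \<psi>]]]
    test_functions_L2[OF \<psi>'] test_functions_L2[OF q] test_functions_L2[OF r]
  have Dq: "D (\<lambda>y. of_real (y - l) * cnj (\<psi> y)) y = of_real (y - l) * cnj (D \<psi> y) + cnj (\<psi> y)" for y
  proof -
    have "((\<lambda>y. complex_of_real (y - l)) has_vector_derivative of_real 1) (at y)"
      by (intro has_vector_derivative_of_real) (auto intro!: derivative_eq_intros)
    from has_vector_derivative_mult[OF this has_vector_derivative_cnj[OF smooth_has_deriv[OF s]]]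
    show ?thesis
      by (intro vector_derivative_at) simp
  qed
  have real: "Im (\<integral>y. complex_of_real (u y) \<partial>\<mu>) = 0" for u
    by (simp add: integral_complex_of_real)
  have "(\<integral>y. D (D \<psi>) y * (of_real (y - l) * cnj (\<psi> y)) \<partial>\<mu>)
      = - (\<integral>y. D \<psi> y * (of_real (y - l) * cnj (D \<psi> y)) + D \<psi> y * cnj (\<psi> y) \<partial>\<mu>)"
    using test_functions_by_parts[OF smooth_deriv[OF s] q] by (simp only: Dq distrib_left)
  also have "\<dots> = - (\<integral>y. D \<psi> y * (of_real (y - l) * cnj (D \<psi> y)) \<partial>\<mu>) - (\<integral>y. D \<psi> y * cnj (\<psi> y) \<partial>\<mu>)"
    using integrable_L2_mult[OF L(2,6)] integrable_L2_mult[OF L(2,4)] by simp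
  also have "(\<integral>y. D \<psi> y * (of_real (y - l) * cnj (D \<psi> y)) \<partial>\<mu>)
      = (\<integral>y. complex_of_real ((y - l) * (cmod (D \<psi> y))\<^sup>2) \<partial>\<mu>)"
    by (simp only: of_real_mult complex_norm_square mult_ac)
  finally have 1: "Im (\<integral>y. D (D \<psi>) y * (of_real (y - l) * cnj (\<psi> y)) \<partial>\<mu>)
      = - Im (\<integral>y. D \<psi> y * cnj (\<psi> y) \<partial>\<mu>)"
    using real[of "\<lambda>y. (y - l) * (cmod (D \<psi> y))\<^sup>2"] by simp
  have "(\<integral>y. of_real (\<kappa>\<^sup>2) * \<psi> y * (of_real (y - l) * cnj (\<psi> y)) \<partial>\<mu>)
      = (\<integral>y. complex_of_real (\<kappa>\<^sup>2 * (y - l) * (cmod (\<psi> y))\<^sup>2) \<partial>\<mu>)"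
    by (simp only: of_real_mult complex_norm_square mult_ac)
  then have 2: "Im (\<integral>y. of_real (\<kappa>\<^sup>2) * \<psi> y * (of_real (y - l) * cnj (\<psi> y)) \<partial>\<mu>) = 0"
    using real[of "\<lambda>y. \<kappa>\<^sup>2 * (y - l) * (cmod (\<psi> y))\<^sup>2"] by simp
  have "(\<integral>y. of_real (y - l) * helmholtz \<kappa> \<psi> y * cnj (\<psi> y) \<partial>\<mu>)
      = (\<integral>y. D (D \<psi>) y * (of_real (y - l) * cnj (\<psi> y))
          - of_real (\<kappa>\<^sup>2) * \<psi> y * (of_real (y - l) * cnj (\<psi> y)) \<partial>\<mu>)"
    by (intro Bochner_Integration.integral_cong) (auto simp: helmholtz_def algebra_simps)
  also have "\<dots> = (\<integral>y. D (D \<psi>) y * (of_real (y - l) * cnj (\<psi> y)) \<partial>\<mu>)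
      - (\<integral>y. of_real (\<kappa>\<^sup>2) * \<psi> y * (of_real (y - l) * cnj (\<psi> y)) \<partial>\<mu>)"
    using integrable_L2_mult[OF L(3,5)] integrable_L2_mult[OF L2_scale[OF L(1)] L(5)]
    by (rule Bochner_Integration.integral_diff)
  finally show ?thesis using 1 2 by simp
qed

text \<open>Pairing with the conjugate of \<open>\<psi>\<close> gives \<open>U \<le> W * N\<close>.
  Dropping the derivative term and cancelling \<open>N\<close> yields the second claim, which
  inserted into \<open>\<kappa>\<^sup>2 * U \<le> W * (\<kappa>\<^sup>2 * N)\<close> yields the
  first.\<close>

lemma helmholtz_elliptic:
  assumes \<psi>: "\<psi> \<in> test_functions"
  shows "\<kappa>\<^sup>2 * ((L2_norm (D \<psi>))\<^sup>2 + \<kappa>\<^sup>2 * (L2_norm \<psi>)\<^sup>2) \<le> (L2_norm (helmholtz \<kappa> \<psi>))\<^sup>2"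
    and "\<kappa>\<^sup>2 * L2_norm \<psi> \<le> L2_norm (helmholtz \<kappa> \<psi>)"
proof -
  define W where "W = L2_norm (helmholtz \<kappa> \<psi>)"
  define N where "N = L2_norm \<psi>"
  define U where "U = (L2_norm (D \<psi>))\<^sup>2 + \<kappa>\<^sup>2 * N\<^sup>2"
  have nn: "W \<ge> 0" "N \<ge> 0" by (auto simp: W_def N_def)
  have "U = cmod (\<integral>y. helmholtz \<kappa> \<psi> y * cnj (\<psi> y) \<partial>\<mu>)"
    unfolding helmholtz_pairing[OF \<psi>] norm_minus_cancel norm_of_real U_def N_def by simp
  also have "\<dots> \<le> W * N"
    using L2_Cauchy_Schwarz[of "helmholtz \<kappa> \<psi>" "\<lambda>y. cnj (\<psi> y)"]
      test_functions_L2[OF helmholtz_test_function[OF \<psi>]] test_functions_L2[OF \<psi>]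
    by (simp add: L2_norm_cnj W_def N_def L2_cnj)
  finally have U: "U \<le> W * N" .
  have "\<kappa>\<^sup>2 * N\<^sup>2 \<le> W * N" using U zero_le_power2[of "L2_norm (D \<psi>)"] unfolding U_def by linarith
  then have "(\<kappa>\<^sup>2 * N) * N \<le> W * N" by (simp add: power2_eq_square mult.assoc)
  then show 2: "\<kappa>\<^sup>2 * L2_norm \<psi> \<le> L2_norm (helmholtz \<kappa> \<psi>)"
    unfolding W_def[symmetric] N_def[symmetric]
    using nn by (cases "N = 0") (auto intro: mult_right_le_imp_le)
  have "\<kappa>\<^sup>2 * U \<le> \<kappa>\<^sup>2 * (W * N)" using U by (intro mult_left_mono) auto
  also have "\<dots> = W * (\<kappa>\<^sup>2 * N)" by simp
  also have "\<dots> \<le> W * W" using 2 nn by (intro mult_left_mono) (auto simp: W_def N_def)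
  finally show "\<kappa>\<^sup>2 * ((L2_norm (D \<psi>))\<^sup>2 + \<kappa>\<^sup>2 * (L2_norm \<psi>)\<^sup>2) \<le> (L2_norm (helmholtz \<kappa> \<psi>))\<^sup>2"
    by (simp add: U_def W_def N_def power2_eq_square)
qed

section \<open>The energy estimate\<close>

text \<open>The equation tested with \<open>\<psi>\<close>, one Helmholtz operator having been
  transferred to \<open>\<psi>\<close>, so that it makes sense for \<open>w\<close> merely in
  \<open>L2\<close>. The pairing is bilinear, and \<open>\<delta>\<close> stands for the whole
  coefficient of the \<epsilon> term.\<close>

definition OS_form :: "real \<Rightarrow> real \<Rightarrow> real \<Rightarrow> real \<Rightarrow> (real \<Rightarrow> complex) \<Rightarrow> (real \<Rightarrow> complex) \<Rightarrow> complex" where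
  "OS_form \<nu> \<kappa> l \<delta> w \<psi> = - of_real \<nu> * (\<integral>y. w y * helmholtz \<kappa> \<psi> y \<partial>\<mu>)
    + \<i> * of_real \<kappa> * (\<integral>y. w y * (of_real (y - l) * \<psi> y) \<partial>\<mu>)
    - of_real \<delta> * (\<integral>y. w y * \<psi> y \<partial>\<mu>)"

lemma shear_test_function:
  "\<psi> \<in> test_functions \<Longrightarrow> (\<lambda>y. complex_of_real (y - l) * \<psi> y) \<in> test_functions"
  using smooth_diff[OF smooth_of_real smooth_const] by (intro test_functions_mult) simp_all

lemma OS_form_diff:
  assumes "v \<in> L2" "w \<in> L2" "\<psi> \<in> test_functions"
  shows "OS_form \<nu> \<kappa> l \<delta> (\<lambda>y. v y - w y) \<psi> = OS_form \<nu> \<kappa> l \<delta> v \<psi> - OS_form \<nu> \<kappa> l \<delta> w \<psi>"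
proof -
  note L = test_functions_L2[OF assms(3)] test_functions_L2[OF helmholtz_test_function[OF assms(3), of \<kappa>]]
    test_functions_L2[OF shear_test_function[OF assms(3), of l]]
  have split: "(\<integral>y. (v y - w y) * q y \<partial>\<mu>) = (\<integral>y. v y * q y \<partial>\<mu>) - (\<integral>y. w y * q y \<partial>\<mu>)" if "q \<in> L2" for q
    unfolding left_diff_distrib using assms that
    by (intro Bochner_Integration.integral_diff integrable_L2_mult)
  show ?thesis
    unfolding OS_form_def split[OF L(1)] split[OF L(2)] split[OF L(3)] by (simp add: algebra_simps)
qed

text \<open>The dependence on \<open>l\<close> is harmless: the bound is applied only to
  \<open>w\<close> minus the vorticity of an approximant, whose norm tends to 0, so the final
  constant does not involve \<open>l\<close>.\<close>

lemma norm_OS_form_le: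
  assumes w: "w \<in> L2" and \<psi>: "\<psi> \<in> test_functions" and nn: "\<nu> \<ge> 0" "\<delta> \<ge> 0"
  shows "cmod (OS_form \<nu> \<kappa> l \<delta> w \<psi>)
    \<le> L2_norm w * (\<nu> * L2_norm (helmholtz \<kappa> \<psi>) + (\<bar>\<kappa>\<bar> * (1 + \<bar>l\<bar>) + \<delta>) * L2_norm \<psi>)"
proof -
  note L = test_functions_L2[OF \<psi>] test_functions_L2[OF helmholtz_test_function[OF \<psi>, of \<kappa>]]
    test_functions_L2[OF shear_test_function[OF \<psi>, of l]]
  have shear: "L2_norm (\<lambda>y. complex_of_real (y - l) * \<psi> y) \<le> (1 + \<bar>l\<bar>) * L2_norm \<psi>"
  proof (rule L2_mult_bounded(2)[OF L(1)])
    show "(\<lambda>y. complex_of_real (y - l)) \<in> borel_measurable \<mu>"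
      by (intro continuous_measurable continuous_intros)
    show "cmod (complex_of_real (y - l)) \<le> 1 + \<bar>l\<bar>" if "y \<in> I" for y
      unfolding norm_of_real using that by auto
  qed
  have "cmod (OS_form \<nu> \<kappa> l \<delta> w \<psi>)
      \<le> \<nu> * cmod (\<integral>y. w y * helmholtz \<kappa> \<psi> y \<partial>\<mu>)
        + \<bar>\<kappa>\<bar> * cmod (\<integral>y. w y * (of_real (y - l) * \<psi> y) \<partial>\<mu>)
        + \<delta> * cmod (\<integral>y. w y * \<psi> y \<partial>\<mu>)"
    unfolding OS_form_def using nn
    by (intro order_trans[OF norm_triangle_ineq4] add_mono order_trans[OF norm_triangle_ineq])
      (simp_all add: norm_mult)
  also have "\<dots> \<le> \<nu> * (L2_norm w * L2_norm (helmholtz \<kappa> \<psi>))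
      + \<bar>\<kappa>\<bar> * (L2_norm w * ((1 + \<bar>l\<bar>) * L2_norm \<psi>)) + \<delta> * (L2_norm w * L2_norm \<psi>)"
    using nn w L shear
    by (intro add_mono mult_left_mono L2_Cauchy_Schwarz order_trans[OF L2_Cauchy_Schwarz]) auto
  finally show ?thesis by (simp add: algebra_simps)
qed

text \<open>The real part of the form is
  \<open>- \<nu> * W\<^sup>2 + \<kappa> * Im J + \<delta> * U\<close>. For positive
  \<open>\<delta>\<close> the \<epsilon> term thus opposes the viscous term and has to be absorbed
  by it, like the commutator.\<close>

lemma OS_form_coercive:
  assumes \<psi>: "\<psi> \<in> test_functions" and \<kappa>: "\<nu> * \<kappa>\<^sup>2 \<ge> 1"
    and \<delta>: "\<delta> \<le> \<nu> * \<kappa>\<^sup>2 / 4"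
  shows "\<nu> * (L2_norm (helmholtz \<kappa> \<psi>))\<^sup>2 \<le> 4 * cmod (OS_form \<nu> \<kappa> l \<delta> (helmholtz \<kappa> \<psi>) (\<lambda>y. cnj (\<psi> y)))"
proof -
  let ?F = "OS_form \<nu> \<kappa> l \<delta> (helmholtz \<kappa> \<psi>) (\<lambda>y. cnj (\<psi> y))"
  define W where "W = L2_norm (helmholtz \<kappa> \<psi>)"
  define U where "U = (L2_norm (D \<psi>))\<^sup>2 + \<kappa>\<^sup>2 * (L2_norm \<psi>)\<^sup>2"
  define J where "J = (\<integral>y. D \<psi> y * cnj (\<psi> y) \<partial>\<mu>)"
  have \<nu>: "\<nu> > 0"
    using \<kappa> by (smt (verit) mult_nonpos_nonneg zero_le_power2)
  have U0: "U \<ge> 0" by (simp add: U_def)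
  have L: "\<psi> \<in> L2" "D \<psi> \<in> L2" using \<psi> by (auto intro: test_functions_L2 test_functions_deriv)
  have "(\<integral>y. helmholtz \<kappa> \<psi> y * helmholtz \<kappa> (\<lambda>y. cnj (\<psi> y)) y \<partial>\<mu>) = of_real (W\<^sup>2)"
    unfolding helmholtz_cnj[OF \<psi>] integral_mult_cnj W_def ..
  moreover have "(\<integral>y. helmholtz \<kappa> \<psi> y * cnj (\<psi> y) \<partial>\<mu>) = - of_real U"
    unfolding helmholtz_pairing[OF \<psi>] U_def ..
  moreover have "Im (\<integral>y. helmholtz \<kappa> \<psi> y * (of_real (y - l) * cnj (\<psi> y)) \<partial>\<mu>) = - Im J"
    using helmholtz_pairing_shear[OF \<psi>, of l \<kappa>] unfolding J_def by (simp only: mult_ac)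
  ultimately have "Re ?F = - \<nu> * W\<^sup>2 + \<kappa> * Im J + \<delta> * U"
    unfolding OS_form_def by simp
  then have "\<nu> * W\<^sup>2 \<le> cmod ?F + \<bar>\<kappa> * Im J\<bar> + \<delta> * U"
    using abs_Re_le_cmod[of ?F] by linarith
  moreover have "\<bar>\<kappa> * Im J\<bar> \<le> U / 2"
  proof -
    have "\<bar>Im J\<bar> \<le> L2_norm (D \<psi>) * L2_norm \<psi>"
      using L2_Cauchy_Schwarz[OF L(2) L2_cnj[OF L(1)]] abs_Im_le_cmod[of J]
      unfolding L2_norm_cnj J_def by linarith
    then have "\<bar>\<kappa>\<bar> * \<bar>Im J\<bar> \<le> \<bar>\<kappa>\<bar> * (L2_norm (D \<psi>) * L2_norm \<psi>)"
      by (rule mult_left_mono) simp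
    then have "\<bar>\<kappa> * Im J\<bar> \<le> L2_norm (D \<psi>) * (\<bar>\<kappa>\<bar> * L2_norm \<psi>)"
      by (simp add: abs_mult mult_ac)
    also have "\<dots> \<le> U / 2"
      using sum_squares_bound[of "L2_norm (D \<psi>)" "\<bar>\<kappa>\<bar> * L2_norm \<psi>"]
      by (simp add: U_def power_mult_distrib)
    finally show ?thesis .
  qed
  \<comment> \<open>The commutator takes \<open>1 / 2 \<le> \<nu> * \<kappa>\<^sup>2 / 2\<close>,
    and \<open>\<delta>\<close> at most a further quarter of
    \<open>\<nu> * \<kappa>\<^sup>2\<close>; the quarter of \<open>\<nu> * W\<^sup>2\<close> that is
    left produces the factor 4.\<close>
  moreover have "U / 2 + \<delta> * U \<le> 3 / 4 * (\<nu> * W\<^sup>2)"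
  proof -
    have "\<kappa>\<^sup>2 * U \<le> W\<^sup>2"
      using helmholtz_elliptic(1)[OF \<psi>, of \<kappa>] by (simp add: U_def W_def)
    from mult_left_mono[OF this less_imp_le[OF \<nu>]] have "\<nu> * \<kappa>\<^sup>2 * U \<le> \<nu> * W\<^sup>2"
      by (simp add: mult.assoc)
    moreover have "(1 / 2 + \<delta>) * U \<le> (3 / 4 * (\<nu> * \<kappa>\<^sup>2)) * U"
      using \<delta> \<kappa> U0 by (intro mult_right_mono) auto
    ultimately show ?thesis by (simp add: algebra_simps)
  qed
  ultimately show ?thesis unfolding W_def by linarith
qed

text \<open>The hypothesis with \<open>A\<close> bounds the form at \<open>w\<close> itself, while
  coercivity is known at the vorticity of an approximant; \<open>OS_form_diff\<close> connects the
  two with an error proportional to \<open>d n\<close>. In the limit one factor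
  \<open>L2_norm w\<close> cancels, which makes the estimate linear.\<close>

lemma OS_form_estimate:
  assumes w: "w \<in> L2" and \<psi>: "\<And>n. \<psi> n \<in> test_functions"
    and lim: "(\<lambda>n. L2_norm (\<lambda>y. w y - helmholtz \<kappa> (\<psi> n) y)) \<longlonglongrightarrow> 0"
    and lim0: "(\<lambda>n. L2_norm (\<psi> n)) \<longlonglongrightarrow> N"
    and bound: "\<And>n. cmod (OS_form \<nu> \<kappa> l \<delta> w (\<lambda>y. cnj (\<psi> n y))) \<le> A * L2_norm (helmholtz \<kappa> (\<psi> n))"
    and A: "A \<ge> 0" and \<kappa>: "\<nu> * \<kappa>\<^sup>2 \<ge> 1" "\<nu> > 0" and \<delta>: "0 \<le> \<delta>" "\<delta> \<le> \<nu> * \<kappa>\<^sup>2 / 4"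
  shows "\<nu> * L2_norm w \<le> 4 * A"
proof -
  define W where "W n = L2_norm (helmholtz \<kappa> (\<psi> n))" for n
  define d where "d n = L2_norm (\<lambda>y. w y - helmholtz \<kappa> (\<psi> n) y)" for n
  define c where "c = \<bar>\<kappa>\<bar> * (1 + \<bar>l\<bar>) + \<delta>"
  have hL: "helmholtz \<kappa> (\<psi> n) \<in> L2" for n
    using \<psi> by (intro test_functions_L2 helmholtz_test_function)
  have W: "W \<longlonglongrightarrow> L2_norm w"
    unfolding W_def by (rule L2_norm_tendsto[OF w hL lim])
  have le: "\<nu> * (W n)\<^sup>2 \<le> 4 * (A * W n + d n * (\<nu> * W n + c * L2_norm (\<psi> n)))" for n
  proof -
    let ?c = "\<lambda>y. cnj (\<psi> n y)"
    have ct: "?c \<in> test_functions" using \<psi> by (rule test_functions_cnj)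
    have "L2_norm (helmholtz \<kappa> ?c) = W n"
      unfolding W_def L2_norm_def helmholtz_cnj[OF \<psi>] by simp
    then have small: "cmod (OS_form \<nu> \<kappa> l \<delta> (\<lambda>y. w y - helmholtz \<kappa> (\<psi> n) y) ?c)
        \<le> d n * (\<nu> * W n + c * L2_norm (\<psi> n))"
      using norm_OS_form_le[OF L2_diff[OF w hL[of n]] ct less_imp_le[OF \<kappa>(2)] \<delta>(1), of \<kappa> l]
      unfolding d_def c_def L2_norm_cnj by simp
    have eq: "OS_form \<nu> \<kappa> l \<delta> (helmholtz \<kappa> (\<psi> n)) ?c
        = OS_form \<nu> \<kappa> l \<delta> w ?c - OS_form \<nu> \<kappa> l \<delta> (\<lambda>y. w y - helmholtz \<kappa> (\<psi> n) y) ?c"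
      using OS_form_diff[OF w hL ct] by simp
    have "cmod (OS_form \<nu> \<kappa> l \<delta> (helmholtz \<kappa> (\<psi> n)) ?c)
        \<le> A * W n + d n * (\<nu> * W n + c * L2_norm (\<psi> n))"
      using small bound[of n] norm_triangle_ineq4[of "OS_form \<nu> \<kappa> l \<delta> w ?c"
          "OS_form \<nu> \<kappa> l \<delta> (\<lambda>y. w y - helmholtz \<kappa> (\<psi> n) y) ?c"]
      unfolding W_def eq by linarith
    from order_trans[OF OS_form_coercive[OF \<psi> \<kappa>(1) \<delta>(2)] mult_left_mono[OF this]]
    show ?thesis unfolding W_def by simp
  qed
  \<comment> \<open>The error is a null sequence times a convergent one, \<open>lim0\<close>
    supplying the convergence of the norms of \<open>\<psi> n\<close>; the vanishing product is kept
    in the form in which the limit rules deliver it.\<close>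
  have "\<nu> * (L2_norm w)\<^sup>2 \<le> 4 * (A * L2_norm w + 0 * (\<nu> * L2_norm w + c * N))"
  proof (rule LIMSEQ_le)
    show "(\<lambda>n. \<nu> * (W n)\<^sup>2) \<longlonglongrightarrow> \<nu> * (L2_norm w)\<^sup>2"
      using W by (intro tendsto_intros)
    show "(\<lambda>n. 4 * (A * W n + d n * (\<nu> * W n + c * L2_norm (\<psi> n))))
        \<longlonglongrightarrow> 4 * (A * L2_norm w + 0 * (\<nu> * L2_norm w + c * N))"
      using W lim lim0 unfolding d_def by (intro tendsto_intros)
  qed (use le in blast)
  then have "(\<nu> * L2_norm w) * L2_norm w \<le> (4 * A) * L2_norm w"
    by (simp add: power2_eq_square algebra_simps)
  then show ?thesis
    using A mult_right_le_imp_le[of "\<nu> * L2_norm w" "L2_norm w" "4 * A"] L2_norm_nonneg[of w]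
    by (cases "L2_norm w = 0") auto
qed

section \<open>From the distributional equation to the bilinear form\<close>

lemma distr_helmholtz_distr_of:
  assumes g: "has_weak_deriv f g" and h: "has_weak_deriv g h" and \<psi>: "\<psi> \<in> test_functions"
  shows "distr_helmholtz k (distr_of f) \<psi> = (\<integral>y. (h y - of_int (k\<^sup>2) * f y) * \<psi> y \<partial>\<mu>)"
proof -
  have L: "f \<in> L2" "h \<in> L2" using g h by (auto simp: has_weak_deriv_def)
  have \<psi>L: "\<psi> \<in> L2" using \<psi> test_functions_L2 by blast
  have "(\<integral>y. f y * D (D \<psi>) y \<partial>\<mu>) = (\<integral>y. h y * \<psi> y \<partial>\<mu>)"
    using has_weak_deriv_integral[OF g test_functions_deriv[OF \<psi>]] has_weak_deriv_integral[OF h \<psi>] by simp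
  then show ?thesis
    using integrable_L2_mult[OF L(1) \<psi>L] integrable_L2_mult[OF L(2) \<psi>L]
    by (simp add: distr_helmholtz_def distr_deriv_def distr_of_def left_diff_distrib mult.assoc)
qed

text \<open>Only the inner Helmholtz operator acts on \<open>f\<close>, through its two weak
  derivatives; the outer one stays on the test function. The inner identity is used at
  \<open>\<psi>\<close>, at its second derivative and at \<open>\<psi>\<close> times the shear, all
  of which are test functions.\<close>

lemma OS_operator_eq_form:
  assumes g: "has_weak_deriv f g" and h: "has_weak_deriv g h" and \<psi>: "\<psi> \<in> test_functions"
  shows "OS_operator \<epsilon> \<nu> k l (distr_of f) \<psi>
    = OS_form \<nu> (real_of_int k) l (\<epsilon> * \<nu> powr (1/3) * \<bar>real_of_int k\<bar> powr (2/3))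
        (\<lambda>y. h y - of_int (k\<^sup>2) * f y) \<psi>"
proof -
  let ?w = "\<lambda>y. h y - of_int (k\<^sup>2) * f y"
  have L: "f \<in> L2" "h \<in> L2" using g h by (auto simp: has_weak_deriv_def)
  have wL: "?w \<in> L2" using L by auto
  have \<psi>L: "\<psi> \<in> L2" "D (D \<psi>) \<in> L2"
    using \<psi> by (auto intro!: test_functions_L2 test_functions_deriv)
  note eq = distr_helmholtz_distr_of[OF g h]
  have "distr_helmholtz k (distr_helmholtz k (distr_of f)) \<psi>
      = (\<integral>y. ?w y * D (D \<psi>) y \<partial>\<mu>) - of_int (k\<^sup>2) * (\<integral>y. ?w y * \<psi> y \<partial>\<mu>)"
    unfolding distr_helmholtz_def[of k "distr_helmholtz k (distr_of f)"] distr_deriv_def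
      eq[OF \<psi>] eq[OF test_functions_deriv[OF test_functions_deriv[OF \<psi>]]] minus_minus ..
  also have "\<dots> = (\<integral>y. ?w y * D (D \<psi>) y - of_int (k\<^sup>2) * (?w y * \<psi> y) \<partial>\<mu>)"
    using integrable_L2_mult[OF wL \<psi>L(1)] integrable_L2_mult[OF wL \<psi>L(2)] by simp
  also have "\<dots> = (\<integral>y. ?w y * helmholtz (real_of_int k) \<psi> y \<partial>\<mu>)"
    by (intro Bochner_Integration.integral_cong) (auto simp: helmholtz_def algebra_simps)
  finally show ?thesis
    unfolding OS_operator_def distr_mult_def OS_form_def
    using eq[OF shear_test_function[OF \<psi>]] eq[OF \<psi>] by simp
qed

section \<open>Test functions in \<open>H10\<close> and the dual norm\<close>

lemma test_functions_has_weak_deriv: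
  assumes "\<psi> \<in> test_functions"
  shows "has_weak_deriv \<psi> (D \<psi>)"
  unfolding has_weak_deriv_def
proof (intro conjI ballI)
  show "\<psi> \<in> L2" "D \<psi> \<in> L2" using assms by (auto intro: test_functions_L2 test_functions_deriv)
  show "distr_deriv (distr_of \<psi>) \<theta> = distr_of (D \<psi>) \<theta>" if "\<theta> \<in> test_functions" for \<theta>
    using test_functions_by_parts[OF test_functions_smooth[OF assms] that]
    by (simp add: distr_deriv_def distr_of_def)
qed

text \<open>\<open>weak_deriv\<close> is a choice among representatives; uniqueness up to null sets
  lets the classical derivative replace it in the norm.\<close>

lemma test_functions_H1_norm:
  assumes \<psi>: "\<psi> \<in> test_functions"
  shows "H1_norm \<psi> = sqrt ((L2_norm \<psi>)\<^sup>2 + (L2_norm (D \<psi>))\<^sup>2)"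
proof -
  have D: "has_weak_deriv \<psi> (D \<psi>)" using \<psi> by (rule test_functions_has_weak_deriv)
  then have w: "has_weak_deriv \<psi> (weak_deriv \<psi>)"
    by (intro H1_has_weak_deriv) (auto simp: H1_def)
  have "L2_norm (weak_deriv \<psi>) = L2_norm (D \<psi>)"
    using D w by (intro L2_norm_cong_AE weak_deriv_unique[OF w D]) (auto simp: has_weak_deriv_def)
  then show ?thesis by (simp add: H1_norm_def)
qed

lemma test_functions_H10:
  assumes \<psi>: "\<psi> \<in> test_functions"
  shows "\<psi> \<in> H10"
proof -
  have "H1_norm (\<lambda>y. \<psi> y - \<psi> y) = 0"
  proof -
    have z: "(\<lambda>y. \<psi> y - \<psi> y) \<in> test_functions" using \<psi> \<psi> by (rule test_functions_diff)
    show ?thesis unfolding test_functions_H1_norm[OF z] by (simp add: L2_norm_def)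
  qed
  then show ?thesis
    unfolding H10_def using \<psi> test_functions_has_weak_deriv[OF \<psi>]
    by (auto simp: H1_def intro!: exI[of _ "\<lambda>_. \<psi>"])
qed

text \<open>Boundedness of \<open>F\<close> bounds the set of values above, so the supremum is a
  genuine one. The dual inequality follows by rescaling to \<open>H1_norm\<close> equal to 1, and
  nonnegativity by looking at the zero function.\<close>

lemma Hminus1_norm_bound:
  assumes F: "F \<in> Hminus1"
  shows "Hminus1_norm F \<ge> 0"
    and "\<psi> \<in> test_functions \<Longrightarrow> cmod (F \<psi>) \<le> Hminus1_norm F * H1_norm \<psi>"
proof -
  let ?S = "{f \<in> H10. H1_norm f \<le> 1}"
  obtain M where M: "\<And>f. f \<in> H10 \<Longrightarrow> cmod (F f) \<le> M * H1_norm f"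
    using F unfolding Hminus1_def by blast
  have "cmod (F f) \<le> \<bar>M\<bar>" if "f \<in> ?S" for f
  proof -
    have "cmod (F f) \<le> M * H1_norm f" using M that by blast
    also have "\<dots> \<le> \<bar>M\<bar> * 1" using that by (intro mult_mono) (auto simp: H1_norm_def)
    finally show ?thesis by simp
  qed
  then have bdd: "bdd_above ((\<lambda>f. cmod (F f)) ` ?S)" by (auto intro!: bdd_aboveI[of _ "\<bar>M\<bar>"])
  have sup: "cmod (F f) \<le> Hminus1_norm F" if "f \<in> ?S" for f
    unfolding Hminus1_norm_def using that bdd by (rule cSUP_upper)
  have scale: "F (\<lambda>y. c * f y) = c * F f" if "f \<in> H10" for c f
    using F that by (simp add: Hminus1_def)
  have bound: "cmod (F \<psi>) \<le> Hminus1_norm F * H1_norm \<psi>" if \<psi>: "\<psi> \<in> test_functions" for \<psi>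
  proof (cases "H1_norm \<psi> = 0")
    case True
    \<comment> \<open>A function of norm zero cannot be rescaled, but the bound with
      \<open>M\<close> makes \<open>F \<psi>\<close> vanish.\<close>
    then show ?thesis using M[OF test_functions_H10[OF \<psi>]] by simp
  next
    case False
    define s where "s = H1_norm \<psi>"
    have s: "s > 0" using False by (simp add: s_def H1_norm_def less_le)
    let ?f = "\<lambda>y. complex_of_real (1 / s) * \<psi> y"
    have f: "?f \<in> test_functions" using \<psi> by (rule test_functions_scale)
    have Df: "D ?f y = of_real (1 / s) * D \<psi> y" for y
      by (intro vector_derivative_at has_vector_derivative_mult_right smooth_has_deriv
          test_functions_smooth \<psi>)
    have "H1_norm ?f = sqrt ((1 / s)\<^sup>2 * ((L2_norm \<psi>)\<^sup>2 + (L2_norm (D \<psi>))\<^sup>2))"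
      unfolding test_functions_H1_norm[OF f] Df L2_norm_scale norm_of_real
      using s by (simp add: power_mult_distrib power_divide distrib_left)
    also have "\<dots> = (1 / s) * H1_norm \<psi>"
      using s unfolding real_sqrt_mult test_functions_H1_norm[OF \<psi>] by simp
    finally have "H1_norm ?f = 1" using s by (simp add: s_def)
    then have "cmod (F ?f) \<le> Hminus1_norm F" using f by (intro sup) (simp add: test_functions_H10)
    then have "cmod (F \<psi>) / s \<le> Hminus1_norm F"
      using s unfolding scale[OF test_functions_H10[OF \<psi>]] norm_mult norm_of_real by simp
    then show ?thesis using s by (simp add: s_def divide_le_eq)
  qed
  then show "\<psi> \<in> test_functions \<Longrightarrow> cmod (F \<psi>) \<le> Hminus1_norm F * H1_norm \<psi>" .
  obtain \<theta> where "\<theta> \<in> test_functions" by (rule normalized_test_function)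
  then have z: "(\<lambda>y. 0 * \<theta> y) \<in> test_functions" by (rule test_functions_scale)
  then have "H1_norm (\<lambda>y. 0 * \<theta> y) = 0"
    unfolding test_functions_H1_norm[OF z] by (simp add: L2_norm_def)
  with z have "(\<lambda>y. 0 * \<theta> y) \<in> ?S" using test_functions_H10 by simp
  from order_trans[OF norm_ge_zero sup[OF this]] show "Hminus1_norm F \<ge> 0" .
qed

section \<open>Estimates for solutions\<close>

lemma OS_damping_le:
  fixes \<epsilon> \<nu> \<kappa> :: real
  assumes "0 \<le> \<epsilon>" "\<epsilon> \<le> 1 / 4" "\<nu> > 0" "\<nu> * \<kappa>\<^sup>2 \<ge> 1"
  shows "\<epsilon> * \<nu> powr (1/3) * \<bar>\<kappa>\<bar> powr (2/3) \<le> \<nu> * \<kappa>\<^sup>2 / 4"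
proof -
  have "\<kappa> \<noteq> 0" using assms by auto
  then have "\<bar>\<kappa>\<bar> powr (2/3) = (\<kappa>\<^sup>2) powr (1/3)"
    using powr_powr[of "\<bar>\<kappa>\<bar>" 2 "1/3"] by simp
  then have "\<nu> powr (1/3) * \<bar>\<kappa>\<bar> powr (2/3) = (\<nu> * \<kappa>\<^sup>2) powr (1/3)"
    using assms by (simp add: powr_mult)
  \<comment> \<open>The base is at least 1, so raising the exponent from 1/3 to 1 can only increase
    the power.\<close>
  also have "\<dots> \<le> (\<nu> * \<kappa>\<^sup>2) powr 1"
    using assms by (intro powr_mono) auto
  finally have "\<nu> powr (1/3) * \<bar>\<kappa>\<bar> powr (2/3) \<le> \<nu> * \<kappa>\<^sup>2"
    using assms by simp
  from mult_mono[OF assms(2) this] show ?thesis using assms by (simp add: mult.assoc)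
qed

lemma OS_solution_weak_derivs:
  assumes "OS_solution \<epsilon> \<nu> k l F \<phi>"
  shows "has_weak_deriv \<phi> (weak_deriv \<phi>)"
    and "has_weak_deriv (weak_deriv \<phi>) (weak_deriv (weak_deriv \<phi>))"
  using assms by (auto simp: OS_solution_def H2_def intro: H1_has_weak_deriv)

lemma OS_solution_approximation:
  assumes sol: "OS_solution \<epsilon> \<nu> k l F \<phi>"
  obtains \<psi> where "\<And>n. \<psi> n \<in> test_functions"
    "(\<lambda>n. L2_norm (\<lambda>y. vorticity k \<phi> y - helmholtz (real_of_int k) (\<psi> n) y)) \<longlonglongrightarrow> 0"
    "(\<lambda>n. L2_norm (\<psi> n)) \<longlonglongrightarrow> L2_norm \<phi>"
    "(\<lambda>n. L2_norm (D (\<psi> n))) \<longlonglongrightarrow> L2_norm (weak_deriv \<phi>)"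
proof -
  let ?g = "weak_deriv \<phi>" and ?h = "weak_deriv (weak_deriv \<phi>)"
  note wd = OS_solution_weak_derivs[OF sol]
  have L: "\<phi> \<in> L2" "?g \<in> L2" "?h \<in> L2"
    using wd by (auto simp: has_weak_deriv_def)
  have bv: "has_boundary_value \<phi> (-1) 0" "has_boundary_value \<phi> 1 0"
    "has_boundary_value ?g (-1) 0" "has_boundary_value ?g 1 0"
    using sol by (auto simp: OS_solution_def)
  obtain \<psi> where \<psi>: "\<And>n. \<psi> n \<in> test_functions"
    and lim0: "(\<lambda>n. L2_norm (\<lambda>y. \<phi> y - \<psi> n y)) \<longlonglongrightarrow> 0"
    and lim1: "(\<lambda>n. L2_norm (\<lambda>y. ?g y - D (\<psi> n) y)) \<longlonglongrightarrow> 0"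
    and lim2: "(\<lambda>n. L2_norm (\<lambda>y. ?h y - D (D (\<psi> n)) y)) \<longlonglongrightarrow> 0"
    by (rule clamped_approximation[OF wd bv]) (rule that)
  have \<psi>L: "\<psi> n \<in> L2" "D (\<psi> n) \<in> L2" "D (D (\<psi> n)) \<in> L2" for n
    using \<psi> by (auto intro!: test_functions_L2 test_functions_deriv)
  have le: "L2_norm (\<lambda>y. vorticity k \<phi> y - helmholtz (real_of_int k) (\<psi> n) y)
      \<le> L2_norm (\<lambda>y. ?h y - D (D (\<psi> n)) y) + (real_of_int k)\<^sup>2 * L2_norm (\<lambda>y. \<phi> y - \<psi> n y)" for n
  proof -
    let ?c = "- complex_of_real ((real_of_int k)\<^sup>2)"
    have "(\<lambda>y. vorticity k \<phi> y - helmholtz (real_of_int k) (\<psi> n) y)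
        = (\<lambda>y. (?h y - D (D (\<psi> n)) y) + ?c * (\<phi> y - \<psi> n y))"
      by (simp add: vorticity_def helmholtz_def algebra_simps)
    then have "L2_norm (\<lambda>y. vorticity k \<phi> y - helmholtz (real_of_int k) (\<psi> n) y)
        = L2_norm (\<lambda>y. (?h y - D (D (\<psi> n)) y) + ?c * (\<phi> y - \<psi> n y))"
      by (rule arg_cong)
    also have "\<dots> \<le> L2_norm (\<lambda>y. ?h y - D (D (\<psi> n)) y) + L2_norm (\<lambda>y. ?c * (\<phi> y - \<psi> n y))"
      using L \<psi>L by (intro L2_norm_triangle L2_scale L2_diff)
    finally show ?thesis unfolding L2_norm_scale norm_minus_cancel norm_of_real by simp
  qed
  have "(\<lambda>n. L2_norm (\<lambda>y. ?h y - D (D (\<psi> n)) y) + (real_of_int k)\<^sup>2 * L2_norm (\<lambda>y. \<phi> y - \<psi> n y))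
      \<longlonglongrightarrow> 0 + (real_of_int k)\<^sup>2 * 0"
    using lim0 lim2 by (intro tendsto_intros)
  then have lim: "(\<lambda>n. L2_norm (\<lambda>y. ?h y - D (D (\<psi> n)) y) + (real_of_int k)\<^sup>2 * L2_norm (\<lambda>y. \<phi> y - \<psi> n y)) \<longlonglongrightarrow> 0"
    by simp
  have "(\<lambda>n. L2_norm (\<lambda>y. vorticity k \<phi> y - helmholtz (real_of_int k) (\<psi> n) y)) \<longlonglongrightarrow> 0"
    by (rule tendsto_sandwich[OF _ _ tendsto_const lim]) (simp_all add: le)
  then show thesis
    by (rule that[OF \<psi> _ L2_norm_tendsto[OF L(1) \<psi>L(1) lim0] L2_norm_tendsto[OF L(2) \<psi>L(2) lim1]])
qed

lemma OS_solution_vorticity_L2: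
  "OS_solution \<epsilon> \<nu> k l F \<phi> \<Longrightarrow> vorticity k \<phi> \<in> L2"
  unfolding vorticity_def
  using OS_solution_weak_derivs by (intro L2_diff L2_scale) (auto simp: has_weak_deriv_def)

lemma L2_norm_vec_velocity:
  assumes "\<phi> \<in> L2" "weak_deriv \<phi> \<in> L2"
  shows "L2_norm_vec (velocity k \<phi>)
    = sqrt ((L2_norm (weak_deriv \<phi>))\<^sup>2 + (real_of_int k)\<^sup>2 * (L2_norm \<phi>)\<^sup>2)"
proof -
  have "(norm (velocity k \<phi> y))\<^sup>2
      = (cmod (weak_deriv \<phi> y))\<^sup>2 + (real_of_int k)\<^sup>2 * (cmod (\<phi> y))\<^sup>2" for y
    by (simp add: velocity_def norm_Pair norm_mult power_mult_distrib)
  then show ?thesis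
    using L2_integrable_square[OF assms(1)] L2_integrable_square[OF assms(2)]
    by (simp add: L2_norm_vec_def L2_norm_square)
qed

text \<open>The elliptic estimate for the approximating test functions passes to the limit, since
  all norms in it converge.\<close>

lemma velocity_le_vorticity:
  assumes sol: "OS_solution \<epsilon> \<nu> k l F \<phi>" and k: "k \<noteq> 0"
  shows "\<bar>real_of_int k\<bar> * L2_norm_vec (velocity k \<phi>) \<le> L2_norm (vorticity k \<phi>)"
proof -
  let ?k = "real_of_int k"
  obtain \<psi> where \<psi>: "\<And>n. \<psi> n \<in> test_functions"
    and lim: "(\<lambda>n. L2_norm (\<lambda>y. vorticity k \<phi> y - helmholtz ?k (\<psi> n) y)) \<longlonglongrightarrow> 0"
    and lim0: "(\<lambda>n. L2_norm (\<psi> n)) \<longlonglongrightarrow> L2_norm \<phi>"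
    and lim1: "(\<lambda>n. L2_norm (D (\<psi> n))) \<longlonglongrightarrow> L2_norm (weak_deriv \<phi>)"
    by (rule OS_solution_approximation[OF sol]) (rule that)
  have L: "\<phi> \<in> L2" "weak_deriv \<phi> \<in> L2"
    using OS_solution_weak_derivs[OF sol] by (auto simp: has_weak_deriv_def)
  have "(\<lambda>n. L2_norm (helmholtz ?k (\<psi> n))) \<longlonglongrightarrow> L2_norm (vorticity k \<phi>)"
    using \<psi> by (intro L2_norm_tendsto[OF OS_solution_vorticity_L2[OF sol] _ lim]
        test_functions_L2 helmholtz_test_function)
  then have W: "(\<lambda>n. (L2_norm (helmholtz ?k (\<psi> n)))\<^sup>2) \<longlonglongrightarrow> (L2_norm (vorticity k \<phi>))\<^sup>2"
    by (intro tendsto_intros)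
  have "?k\<^sup>2 * ((L2_norm (weak_deriv \<phi>))\<^sup>2 + ?k\<^sup>2 * (L2_norm \<phi>)\<^sup>2) \<le> (L2_norm (vorticity k \<phi>))\<^sup>2"
  proof (rule LIMSEQ_le[OF _ W])
    show "(\<lambda>n. ?k\<^sup>2 * ((L2_norm (D (\<psi> n)))\<^sup>2 + ?k\<^sup>2 * (L2_norm (\<psi> n))\<^sup>2))
        \<longlonglongrightarrow> ?k\<^sup>2 * ((L2_norm (weak_deriv \<phi>))\<^sup>2 + ?k\<^sup>2 * (L2_norm \<phi>)\<^sup>2)"
      using lim0 lim1 by (intro tendsto_intros)
    show "\<exists>N. \<forall>n\<ge>N. ?k\<^sup>2 * ((L2_norm (D (\<psi> n)))\<^sup>2 + ?k\<^sup>2 * (L2_norm (\<psi> n))\<^sup>2)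
        \<le> (L2_norm (helmholtz ?k (\<psi> n)))\<^sup>2"
      using helmholtz_elliptic(1)[OF \<psi>, of ?k] by blast
  qed
  then have "(\<bar>?k\<bar> * L2_norm_vec (velocity k \<phi>))\<^sup>2 \<le> (L2_norm (vorticity k \<phi>))\<^sup>2"
    by (simp add: power_mult_distrib L2_norm_vec_velocity[OF L])
  then show ?thesis by (rule power2_le_imp_le) simp
qed

text \<open>The common core of both cases: \<open>F\<close> enters only through a constant
  \<open>A\<close> that measures it against the vorticity of test functions, and each case computes
  its own \<open>A\<close>.\<close>

lemma vorticity_estimate:
  assumes sol: "OS_solution \<epsilon> \<nu> k l F \<phi>"
    and \<epsilon>: "0 \<le> \<epsilon>" "\<epsilon> \<le> 1 / 4" and \<nu>: "\<nu> > 0" "\<nu> * (real_of_int k)\<^sup>2 \<ge> 1" and A: "A \<ge> 0"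
    and bound: "\<And>\<psi>. \<psi> \<in> test_functions \<Longrightarrow>
      cmod (F \<psi>) \<le> A * L2_norm (helmholtz (real_of_int k) \<psi>)"
  shows "\<nu> * L2_norm (vorticity k \<phi>) \<le> 4 * A"
proof -
  let ?k = "real_of_int k"
  obtain \<psi> where \<psi>: "\<And>n. \<psi> n \<in> test_functions"
    and lim: "(\<lambda>n. L2_norm (\<lambda>y. vorticity k \<phi> y - helmholtz ?k (\<psi> n) y)) \<longlonglongrightarrow> 0"
    and lim0: "(\<lambda>n. L2_norm (\<psi> n)) \<longlonglongrightarrow> L2_norm \<phi>"
    by (rule OS_solution_approximation[OF sol]) (rule that)
  show ?thesis
  proof (rule OS_form_estimate[OF OS_solution_vorticity_L2[OF sol] \<psi> lim lim0 _ A \<nu>(2,1) _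
        OS_damping_le[OF \<epsilon> \<nu>]])
    fix n
    \<comment> \<open>The pairing is bilinear, so the equation is tested with the conjugate of the
      approximant.\<close>
    have c: "(\<lambda>y. cnj (\<psi> n y)) \<in> test_functions" using \<psi> by (rule test_functions_cnj)
    have "L2_norm (helmholtz ?k (\<lambda>y. cnj (\<psi> n y))) = L2_norm (helmholtz ?k (\<psi> n))"
      unfolding L2_norm_def helmholtz_cnj[OF \<psi>] by simp
    moreover have "F (\<lambda>y. cnj (\<psi> n y)) = OS_form \<nu> ?k l
        (\<epsilon> * \<nu> powr (1/3) * \<bar>?k\<bar> powr (2/3)) (vorticity k \<phi>) (\<lambda>y. cnj (\<psi> n y))"
      unfolding vorticity_def OS_operator_eq_form[OF OS_solution_weak_derivs[OF sol] c, symmetric]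
      using sol c by (simp add: OS_solution_def)
    ultimately show "cmod (OS_form \<nu> ?k l (\<epsilon> * \<nu> powr (1/3) * \<bar>?k\<bar> powr (2/3)) (vorticity k \<phi>)
        (\<lambda>y. cnj (\<psi> n y))) \<le> A * L2_norm (helmholtz ?k (\<psi> n))"
      using bound[OF c] by simp
  qed (use \<epsilon> \<nu> in auto)
qed

lemma vorticity_estimate_L2:
  assumes F: "F \<in> L2" and sol: "OS_solution \<epsilon> \<nu> k l (distr_of F) \<phi>"
    and \<epsilon>: "0 \<le> \<epsilon>" "\<epsilon> \<le> 1 / 4" and \<nu>: "\<nu> > 0" "\<nu> * (real_of_int k)\<^sup>2 \<ge> 1"
  shows "\<nu> * (real_of_int k)\<^sup>2 * L2_norm (vorticity k \<phi>) \<le> 4 * L2_norm F"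
proof -
  let ?k = "real_of_int k"
  have k: "?k \<noteq> 0" using \<nu> by auto
  \<comment> \<open>Here \<open>A\<close> is \<open>L2_norm F / ?k\<^sup>2\<close>: the elliptic
    bound controls \<open>L2_norm \<psi>\<close> with a gain of \<open>?k\<^sup>2\<close>.\<close>
  have "\<nu> * L2_norm (vorticity k \<phi>) \<le> 4 * (L2_norm F / ?k\<^sup>2)"
  proof (rule vorticity_estimate[OF sol \<epsilon> \<nu>])
    fix \<psi> assume \<psi>: "\<psi> \<in> test_functions"
    have "cmod (distr_of F \<psi>) \<le> L2_norm F * L2_norm \<psi>"
      unfolding distr_of_def using L2_Cauchy_Schwarz[OF F test_functions_L2[OF \<psi>]] .
    also have "\<dots> \<le> L2_norm F * (L2_norm (helmholtz ?k \<psi>) / ?k\<^sup>2)"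
      using helmholtz_elliptic(2)[OF \<psi>, of ?k] k
      by (intro mult_left_mono) (simp_all add: le_divide_eq mult.commute)
    finally show "cmod (distr_of F \<psi>) \<le> L2_norm F / ?k\<^sup>2 * L2_norm (helmholtz ?k \<psi>)" by simp
  qed simp
  then show ?thesis using k by (simp add: field_simps)
qed

text \<open>Since \<open>k\<^sup>2 \<ge> 1\<close>, the \<open>H1\<close> norm of a test function is
  at most the \<open>L2\<close> norm of its velocity, which the elliptic bound controls with a gain
  of \<open>\<bar>k\<bar>\<close>. Only one power is gained, hence the weaker weight in the
  conclusion.\<close>

lemma vorticity_estimate_Hminus1:
  assumes F: "F \<in> Hminus1" and sol: "OS_solution \<epsilon> \<nu> k l F \<phi>"
    and \<epsilon>: "0 \<le> \<epsilon>" "\<epsilon> \<le> 1 / 4" and \<nu>: "\<nu> > 0" "\<nu> * (real_of_int k)\<^sup>2 \<ge> 1" and k: "\<bar>k\<bar> \<ge> 1"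
  shows "\<nu> * \<bar>real_of_int k\<bar> * L2_norm (vorticity k \<phi>) \<le> 4 * Hminus1_norm F"
proof -
  let ?k = "real_of_int k"
  have "1 \<le> \<bar>?k\<bar>" using k by linarith
  then have k0: "\<bar>?k\<bar> > 0" and k1: "1 \<le> ?k\<^sup>2"
    using one_le_power[of "\<bar>?k\<bar>" 2] by simp_all
  have "\<nu> * L2_norm (vorticity k \<phi>) \<le> 4 * (Hminus1_norm F / \<bar>?k\<bar>)"
  proof (rule vorticity_estimate[OF sol \<epsilon> \<nu>])
    fix \<psi> assume \<psi>: "\<psi> \<in> test_functions"
    let ?U = "(L2_norm (D \<psi>))\<^sup>2 + ?k\<^sup>2 * (L2_norm \<psi>)\<^sup>2"
    have "(L2_norm \<psi>)\<^sup>2 + (L2_norm (D \<psi>))\<^sup>2 \<le> ?U"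
      using mult_right_mono[OF k1, of "(L2_norm \<psi>)\<^sup>2"] by simp
    then have "?k\<^sup>2 * ((L2_norm \<psi>)\<^sup>2 + (L2_norm (D \<psi>))\<^sup>2) \<le> ?k\<^sup>2 * ?U"
      by (rule mult_left_mono) simp
    also have "\<dots> \<le> (L2_norm (helmholtz ?k \<psi>))\<^sup>2"
      using helmholtz_elliptic(1)[OF \<psi>, of ?k] .
    finally have "(\<bar>?k\<bar> * H1_norm \<psi>)\<^sup>2 \<le> (L2_norm (helmholtz ?k \<psi>))\<^sup>2"
      by (simp add: power_mult_distrib test_functions_H1_norm[OF \<psi>])
    then have "\<bar>?k\<bar> * H1_norm \<psi> \<le> L2_norm (helmholtz ?k \<psi>)"
      by (rule power2_le_imp_le) simp
    then have "H1_norm \<psi> \<le> L2_norm (helmholtz ?k \<psi>) / \<bar>?k\<bar>"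
      using k0 by (simp add: pos_le_divide_eq mult.commute)
    from mult_left_mono[OF this Hminus1_norm_bound(1)[OF F]]
    show "cmod (F \<psi>) \<le> Hminus1_norm F / \<bar>?k\<bar> * L2_norm (helmholtz ?k \<psi>)"
      using Hminus1_norm_bound(2)[OF F \<psi>] by simp
  qed (use Hminus1_norm_bound(1)[OF F] in simp)
  then show ?thesis using k0 by (simp add: field_simps)
qed

theorem proposition4p5:
  shows "\<exists>\<epsilon>\<^sub>0 C :: real. \<epsilon>\<^sub>0 > 0 \<and> C > 0 \<and>
    (\<forall>(\<epsilon>::real) (\<nu>::real) (k::int) (lam::real) (\<phi>::real \<Rightarrow> complex).
       0 \<le> \<epsilon> \<and> \<epsilon> \<le> \<epsilon>\<^sub>0 \<and> 0 < \<nu> \<and> \<nu> \<le> 1 \<and> \<bar>k\<bar> \<ge> 1 \<and> \<nu> * (real_of_int k)\<^sup>2 \<ge> 1 \<longrightarrow>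
       (\<forall>F\<in>L2. OS_solution \<epsilon> \<nu> k lam (distr_of F) \<phi> \<longrightarrow>
          \<nu> powr (5/12) * \<bar>real_of_int k\<bar> powr (5/6) * L2_norm (vorticity k \<phi>)
            \<le> \<nu> * (real_of_int k)\<^sup>2 * L2_norm (vorticity k \<phi>) \<and>
          \<nu> * (real_of_int k)\<^sup>2 * L2_norm (vorticity k \<phi>) \<le> C * L2_norm F) \<and>
       (\<forall>F\<in>Hminus1. OS_solution \<epsilon> \<nu> k lam F \<phi> \<longrightarrow>
          (\<nu> * (real_of_int k)\<^sup>2) powr (1/2) * L2_norm_vec (velocity k \<phi>)
            \<le> C * (\<nu> * (real_of_int k)\<^sup>2 * L2_norm_vec (velocity k \<phi>)) \<and>
          C * (\<nu> * (real_of_int k)\<^sup>2 * L2_norm_vec (velocity k \<phi>)) \<le> C\<^sup>2 * Hminus1_norm F \<and>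
          \<nu> powr (3/4) * \<bar>real_of_int k\<bar> powr (1/2) * L2_norm (vorticity k \<phi>)
            \<le> C * (\<nu> * \<bar>real_of_int k\<bar> * L2_norm (vorticity k \<phi>)) \<and>
          C * (\<nu> * \<bar>real_of_int k\<bar> * L2_norm (vorticity k \<phi>)) \<le> C\<^sup>2 * Hminus1_norm F))"
\<comment> \<open>Both witnesses come from \<open>OS_form_coercive\<close>: 1/4 is the share of the
  viscous term granted to the \<epsilon> term, and 4 is the factor lost in the absorption. In case
  (ii) the first inequality of each chain already holds with factor 1, so 4 serves there as
  well.\<close>
proof (rule exI[of _ "1/4"], rule exI[of _ 4], intro conjI allI impI ballI; (elim conjE)?)
  fix \<epsilon> \<nu> l :: real and k :: int and \<phi> :: "real \<Rightarrow> complex"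
  let ?k = "real_of_int k" and ?W = "L2_norm (vorticity k \<phi>)" and ?U = "L2_norm_vec (velocity k \<phi>)"
  assume \<epsilon>: "0 \<le> \<epsilon>" "\<epsilon> \<le> 1 / 4" and \<nu>: "0 < \<nu>" "1 \<le> \<nu> * ?k\<^sup>2" and k: "1 \<le> \<bar>k\<bar>"
  have k0: "\<bar>?k\<bar> > 0" "k \<noteq> 0" using k by auto
  \<comment> \<open>Both sides are powers of \<open>\<nu> * ?k\<^sup>2\<close>, which is at least 1;
    \<open>a = 5/12\<close> gives the exponents in the claim.\<close>
  have powr_le: "\<nu> powr a * \<bar>?k\<bar> powr (2 * a) \<le> \<nu> * ?k\<^sup>2" if "a \<le> 1" for a
  proof -
    have "\<bar>?k\<bar> powr (2 * a) = (?k\<^sup>2) powr a"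
      using k0 powr_powr[of "\<bar>?k\<bar>" 2 a] by simp
    then have "\<nu> powr a * \<bar>?k\<bar> powr (2 * a) = (\<nu> * ?k\<^sup>2) powr a"
      using \<nu>(1) by (simp add: powr_mult)
    also have "\<dots> \<le> (\<nu> * ?k\<^sup>2) powr 1" using \<nu>(2) that by (rule powr_mono[rotated])
    finally show ?thesis using \<nu> by simp
  qed
  have U0: "?U \<ge> 0" by (simp add: L2_norm_vec_def)
  show "\<nu> powr (5/12) * \<bar>?k\<bar> powr (5/6) * ?W \<le> \<nu> * ?k\<^sup>2 * ?W"
    using powr_le[of "5/12"] by (intro mult_right_mono) auto
  show "(\<nu> * ?k\<^sup>2) powr (1/2) * ?U \<le> 4 * (\<nu> * ?k\<^sup>2 * ?U)"
  proof -
    have "(\<nu> * ?k\<^sup>2) powr (1/2) \<le> (\<nu> * ?k\<^sup>2) powr 1" using \<nu>(2) by (intro powr_mono) auto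
    then have "(\<nu> * ?k\<^sup>2) powr (1/2) * ?U \<le> \<nu> * ?k\<^sup>2 * ?U"
      using \<nu> U0 by (intro mult_right_mono) auto
    moreover have "0 \<le> \<nu> * ?k\<^sup>2 * ?U" using \<nu> U0 by simp
    ultimately show ?thesis by linarith
  qed
  show "\<nu> powr (3/4) * \<bar>?k\<bar> powr (1/2) * ?W \<le> 4 * (\<nu> * \<bar>?k\<bar> * ?W)"
  proof -
    have "\<nu> powr (3/4) * \<bar>?k\<bar> powr (1/2) \<le> \<nu> * \<bar>?k\<bar>"
    proof -
      have "\<nu> powr (3/4) * \<bar>?k\<bar> powr (1/2) = (\<nu> powr (3/4) * \<bar>?k\<bar> powr (1/2)) * 1" by simp
      \<comment> \<open>The inserted factor is \<open>(\<nu> * ?k\<^sup>2) powr (1/4)\<close>,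
        chosen to raise both exponents to 1.\<close>
      also have "\<dots> \<le> (\<nu> powr (3/4) * \<bar>?k\<bar> powr (1/2)) * (\<nu> powr (1/4) * \<bar>?k\<bar> powr (1/2))"
      proof (rule mult_left_mono)
        have "1 \<le> (\<nu> * ?k\<^sup>2) powr (1/4)" using \<nu>(2) by (simp add: ge_one_powr_ge_zero)
        also have "\<dots> = \<nu> powr (1/4) * \<bar>?k\<bar> powr (1/2)"
          using k0 \<nu>(1) powr_powr[of "\<bar>?k\<bar>" 2 "1/4"] by (simp add: powr_mult)
        finally show "1 \<le> \<nu> powr (1/4) * \<bar>?k\<bar> powr (1/2)" .
      qed simp
      also have "\<dots> = (\<nu> powr (3/4) * \<nu> powr (1/4)) * (\<bar>?k\<bar> powr (1/2) * \<bar>?k\<bar> powr (1/2))"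
        by (simp only: mult_ac)
      also have "\<dots> = \<nu> * \<bar>?k\<bar>"
        using \<nu>(1) k0 by (simp flip: powr_add)
      finally show ?thesis .
    qed
    then have "\<nu> powr (3/4) * \<bar>?k\<bar> powr (1/2) * ?W \<le> \<nu> * \<bar>?k\<bar> * ?W"
      by (intro mult_right_mono) auto
    moreover have "0 \<le> \<nu> * \<bar>?k\<bar> * ?W" using \<nu> by simp
    ultimately show ?thesis by linarith
  qed
  show "\<nu> * ?k\<^sup>2 * ?W \<le> 4 * L2_norm F" if "F \<in> L2" "OS_solution \<epsilon> \<nu> k l (distr_of F) \<phi>" for F
    using that \<epsilon> \<nu> by (rule vorticity_estimate_L2)
  fix F assume F: "F \<in> Hminus1" and sol: "OS_solution \<epsilon> \<nu> k l F \<phi>"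
  have est: "\<nu> * \<bar>?k\<bar> * ?W \<le> 4 * Hminus1_norm F"
    using F sol \<epsilon> \<nu> k by (rule vorticity_estimate_Hminus1)
  then show "4 * (\<nu> * \<bar>?k\<bar> * ?W) \<le> 4\<^sup>2 * Hminus1_norm F" by simp
  \<comment> \<open>One factor \<open>\<bar>?k\<bar>\<close> is spent on passing from the velocity
    to the vorticity, which reduces the claim to \<open>est\<close>.\<close>
  have "\<nu> * ?k\<^sup>2 * ?U = \<nu> * \<bar>?k\<bar> * (\<bar>?k\<bar> * ?U)" by (simp add: power2_eq_square)
  also have "\<dots> \<le> \<nu> * \<bar>?k\<bar> * ?W"
    using velocity_le_vorticity[OF sol k0(2)] \<nu>(1) by (intro mult_left_mono) auto
  also note est
  finally show "4 * (\<nu> * ?k\<^sup>2 * ?U) \<le> 4\<^sup>2 * Hminus1_norm F"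
    by (simp add: mult.assoc mult.commute mult.left_commute)
qed simp_all

end
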